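(* On the tangent bundle $(TH_3,g^s)$ of the Heisenberg manifold $(H_3,g)$, endowed with the Sasaki metric, the distributions $F^H=L(E_1^H,E_2^H)$ and $F^V=L(E_1^V,E_2^V)$ are totally geodesic and they are not isocline.
   Context: The Heisenberg manifold $(H_3,g)$ is $\mathbb{R}^3$ with coordinates $(x^1,x^2,x^3)$ and metric $g=(dx^1)^2+(dx^2)^2+(dx^3+x^2dx^1-x^1dx^2)^2$. An orthonormal frame is $E_1=\frac{\partial}{\partial x^1}-x^2\frac{\partial}{\partial x^3}$, $E_2=\frac{\partial}{\partial x^2}+x^1\frac{\partial}{\partial x^3}$, $E_3=\frac{\partial}{\partial x^3}$. Let $\tau:TH_3\to H_3$ be the tangent bundle, with induced coordinates $(x^1,x^2,x^3,y^1,y^2,y^3)$, where $y^i$ are the components of a tangent vector $y^i\frac{\partial}{\partial x^i}$. For a vector field $X=X^i\frac{\partial}{\partial x^i}$ on $H_3$, the vertical lift is $X^V=X^i\frac{\partial}{\partial y^i}$ and the horizontal lift is $X^H=X^i\frac{\delta}{\delta x^i}$, where $\frac{\delta}{\delta x^j}=\frac{\partial}{\partial x^j}-y^k\Gamma^h_{kj}\frac{\partial}{\partial y^h}$ and $\Gamma^h_{kj}$ are the Christoffel symbols of $g$. The Sasaki metric $g^s$ on $TH_3$ is defined by $g^s(X^H,Y^H)=g^s(X^V,Y^V)=g(X,Y)\circ\tau$ and $g^s(X^H,Y^V)=g^s(X^V,Y^H)=0$. $L(A,B)$ denotes the rank-$2$ distribution spanned by the vector fields $A,B$. A distribution $F$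 on a Riemannian manifold is called totally geodesic if every geodesic which is tangent to $F$ at one point is tangent to $F$ at all of its points. A totally geodesic distribution $F$ is called isocline if for every geodesic $\gamma$ parametrized by arc length, the angle between $F$ and the tangent vector $\dot\gamma(s)$ (i.e. the angle between $\dot\gamma(s)$ and the subspace $F_{\gamma(s)}$) is constant along $\gamma$. *)

theory Defs
  imports "HOL-Analysis.Analysis"
begin

text \<open>A Riemannian metric on the manifold \<open>\<real>\<^sup>n\<close> (with its global chart) is given as the field
  \<open>x \<mapsto> g\<^sub>x\<close> of bilinear forms on tangent vectors, the latter being identified with their
  component vectors with respect to the coordinate fields.\<close>

type_synonym 'n metric = "real ^ 'n \<Rightarrow> real ^ 'n \<Rightarrow> real ^ 'n \<Rightarrow> real"
type_synonym 'n vfield = "real ^ 'n \<Rightarrow> real ^ 'n"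
type_synonym 'n distribution = "real ^ 'n \<Rightarrow> (real ^ 'n) set"

definition partial_deriv :: "'n \<Rightarrow> (real ^ 'n \<Rightarrow> real) \<Rightarrow> real ^ 'n \<Rightarrow> real" where
  "partial_deriv k f x = deriv (\<lambda>t. f (x + t *\<^sub>R axis k 1)) 0"

definition metric_coeff :: "('n::finite) metric \<Rightarrow> 'n \<Rightarrow> 'n \<Rightarrow> real ^ 'n \<Rightarrow> real" where
  "metric_coeff g i j x = g x (axis i 1) (axis j 1)"

definition inverse_coeff :: "('n::finite) metric \<Rightarrow> 'n \<Rightarrow> 'n \<Rightarrow> real ^ 'n \<Rightarrow> real" where
  "inverse_coeff g i j x = matrix_inv (\<chi> k l. metric_coeff g k l x) $ i $ j"

text \<open>\<open>christoffel g h k j x\<close> is \<open>\<Gamma>\<^sup>h\<^sub>k\<^sub>j\<close> at \<open>x\<close>.\<close>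

definition christoffel :: "('n::finite) metric \<Rightarrow> 'n \<Rightarrow> 'n \<Rightarrow> 'n \<Rightarrow> real ^ 'n \<Rightarrow> real" where
  "christoffel g h k j x =
     1 / 2 * (\<Sum>l\<in>UNIV. inverse_coeff g h l x *
       (partial_deriv k (metric_coeff g l j) x + partial_deriv j (metric_coeff g l k) x
        - partial_deriv l (metric_coeff g k j) x))"

definition velocity :: "(real \<Rightarrow> real ^ 'n) \<Rightarrow> real \<Rightarrow> real ^ 'n" where
  "velocity \<gamma> t = vector_derivative \<gamma> (at t)"

text \<open>Geodesics are defined on open intervals and are not assumed to be maximal.  They are affinely
  parametrized.\<close>

definition geodesic_on :: "('n::finite) metric \<Rightarrow> real set \<Rightarrow> (real \<Rightarrow> real ^ 'n) \<Rightarrow> bool" where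
  "geodesic_on g J \<gamma> \<longleftrightarrow>
     open J \<and> is_interval J \<and>
     (\<forall>t\<in>J. \<gamma> differentiable (at t) \<and> velocity \<gamma> differentiable (at t) \<and>
       (\<forall>h. velocity (velocity \<gamma>) t $ h +
          (\<Sum>k\<in>UNIV. \<Sum>j\<in>UNIV.
             christoffel g h k j (\<gamma> t) * velocity \<gamma> t $ k * velocity \<gamma> t $ j) = 0))"

definition metric_norm :: "('n::finite) metric \<Rightarrow> real ^ 'n \<Rightarrow> real ^ 'n \<Rightarrow> real" where
  "metric_norm g x v = sqrt (g x v v)"

definition arc_length_parametrized :: "('n::finite) metric \<Rightarrow> real set \<Rightarrow> (real \<Rightarrow> real ^ 'n) \<Rightarrow> bool" where
  "arc_length_parametrized g J \<gamma> \<longleftrightarrow> (\<forall>t\<in>J. metric_norm g (\<gamma> t) (velocity \<gamma> t) = 1)"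

definition metric_angle :: "('n::finite) metric \<Rightarrow> real ^ 'n \<Rightarrow> real ^ 'n \<Rightarrow> real ^ 'n \<Rightarrow> real" where
  "metric_angle g x v w = arccos (g x v w / (metric_norm g x v * metric_norm g x w))"

text \<open>The angle between a nonzero vector and a nonzero subspace is the smallest angle that the
  vector makes with a nonzero element of the subspace; it lies in \<open>[0, \<pi>/2]\<close>.\<close>

definition angle_to_subspace :: "('n::finite) metric \<Rightarrow> real ^ 'n \<Rightarrow> real ^ 'n \<Rightarrow> (real ^ 'n) set \<Rightarrow> real" where
  "angle_to_subspace g x v S = (INF w\<in>S - {0}. metric_angle g x v w)"

definition spanned_distribution :: "('n::finite) vfield \<Rightarrow> 'n vfield \<Rightarrow> 'n distribution" where
  "spanned_distribution A B p = span {A p, B p}"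

definition tangent_at :: "('n::finite) distribution \<Rightarrow> (real \<Rightarrow> real ^ 'n) \<Rightarrow> real \<Rightarrow> bool" where
  "tangent_at F \<gamma> t \<longleftrightarrow> velocity \<gamma> t \<in> F (\<gamma> t)"

definition totally_geodesic :: "('n::finite) metric \<Rightarrow> 'n distribution \<Rightarrow> bool" where
  "totally_geodesic g F \<longleftrightarrow>
     (\<forall>J \<gamma>. geodesic_on g J \<gamma> \<longrightarrow> (\<exists>t\<in>J. tangent_at F \<gamma> t) \<longrightarrow> (\<forall>t\<in>J. tangent_at F \<gamma> t))"

definition isocline :: "('n::finite) metric \<Rightarrow> 'n distribution \<Rightarrow> bool" where
  "isocline g F \<longleftrightarrow> totally_geodesic g F \<and>
     (\<forall>J \<gamma>. geodesic_on g J \<gamma> \<longrightarrow> arc_length_parametrized g J \<gamma> \<longrightarrow>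
       (\<exists>\<theta>. \<forall>s\<in>J. angle_to_subspace g (\<gamma> s) (velocity \<gamma> s) (F (\<gamma> s)) = \<theta>))"

text \<open>The tangent bundle of \<open>\<real>\<^sup>n\<close> is \<open>\<real>\<^sup>n\<^sup>+\<^sup>n\<close>: the coordinate \<open>x\<^sup>i\<close> has index \<open>Inl i\<close> and the
  fibre coordinate \<open>y\<^sup>i\<close> has index \<open>Inr i\<close>.\<close>

definition base_point :: "real ^ (('n::finite) + 'n) \<Rightarrow> real ^ 'n" where
  "base_point p = (\<chi> i. p $ Inl i)"

definition partial_x :: "('n::finite) \<Rightarrow> real ^ ('n + 'n)" where
  "partial_x i = axis (Inl i) 1"

definition partial_y :: "('n::finite) \<Rightarrow> real ^ ('n + 'n)" where
  "partial_y i = axis (Inr i) 1"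

definition delta_x :: "('n::finite) metric \<Rightarrow> 'n \<Rightarrow> ('n + 'n) vfield" where
  "delta_x g j p = partial_x j -
     (\<Sum>h\<in>UNIV. \<Sum>k\<in>UNIV. (p $ Inr k * christoffel g h k j (base_point p)) *\<^sub>R partial_y h)"

definition vertical_lift :: "('n::finite) vfield \<Rightarrow> ('n + 'n) vfield" where
  "vertical_lift X p = (\<Sum>i\<in>UNIV. X (base_point p) $ i *\<^sub>R partial_y i)"

definition horizontal_lift :: "('n::finite) metric \<Rightarrow> 'n vfield \<Rightarrow> ('n + 'n) vfield" where
  "horizontal_lift g X p = (\<Sum>i\<in>UNIV. X (base_point p) $ i *\<^sub>R delta_x g i p)"

text \<open>The vector fields \<open>X\<close>, \<open>Y\<close> need not be smooth here: the conditions only involve their values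
  at the base point.\<close>

definition is_sasaki_metric :: "('n::finite) metric \<Rightarrow> ('n + 'n) metric \<Rightarrow> bool" where
  "is_sasaki_metric g G \<longleftrightarrow>
     (\<forall>p. bilinear (G p)) \<and>
     (\<forall>X Y p.
        G p (horizontal_lift g X p) (horizontal_lift g Y p)
          = g (base_point p) (X (base_point p)) (Y (base_point p)) \<and>
        G p (vertical_lift X p) (vertical_lift Y p)
          = g (base_point p) (X (base_point p)) (Y (base_point p)) \<and>
        G p (horizontal_lift g X p) (vertical_lift Y p) = 0 \<and>
        G p (vertical_lift X p) (horizontal_lift g Y p) = 0)"

definition sasaki_metric :: "('n::finite) metric \<Rightarrow> ('n + 'n) metric" where
  "sasaki_metric g = (THE G. is_sasaki_metric g G)"

lemma horizontal_lift_nth: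
  "horizontal_lift g X p $ Inl i = X (base_point p) $ i"
  "horizontal_lift g X p $ Inr h =
     - (\<Sum>j\<in>UNIV. X (base_point p) $ j *
          (\<Sum>k\<in>UNIV. p $ Inr k * christoffel g h k j (base_point p)))"
proof -
  have d: "delta_x g j p $ Inl i = (if i = j then 1 else 0)" for j
    by (simp add: delta_x_def partial_x_def partial_y_def axis_def)
  have e: "delta_x g j p $ Inr h = - (\<Sum>k\<in>UNIV. p $ Inr k * christoffel g h k j (base_point p))" for j
  proof -
    have "(\<Sum>k\<in>UNIV. p $ Inr k * christoffel g h' k j (base_point p) * (partial_y h' $ Inr h)) =
        (if h' = h then (\<Sum>k\<in>UNIV. p $ Inr k * christoffel g h' k j (base_point p)) else 0)" for h'
      by (simp add: partial_y_def axis_def)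
    then have "delta_x g j p $ Inr h =
        - (\<Sum>h'\<in>UNIV. if h' = h then (\<Sum>k\<in>UNIV. p $ Inr k * christoffel g h' k j (base_point p)) else 0)"
      by (simp add: delta_x_def partial_x_def axis_def)
    then show ?thesis by simp
  qed
  show "horizontal_lift g X p $ Inl i = X (base_point p) $ i"
    by (simp add: horizontal_lift_def d if_distrib cong: if_cong)
  show "horizontal_lift g X p $ Inr h =
     - (\<Sum>j\<in>UNIV. X (base_point p) $ j *
          (\<Sum>k\<in>UNIV. p $ Inr k * christoffel g h k j (base_point p)))"
    by (simp add: horizontal_lift_def e sum_negf)
qed

lemma vertical_lift_nth:
  "vertical_lift X p $ Inl i = 0"
  "vertical_lift X p $ Inr i = X (base_point p) $ i"
  by (simp_all add: vertical_lift_def partial_y_def axis_def if_distrib cong: if_cong)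

definition horizontal_part :: "real ^ (('n::finite) + 'n) \<Rightarrow> real ^ 'n" where
  "horizontal_part u = (\<chi> i. u $ Inl i)"

definition vertical_part :: "('n::finite) metric \<Rightarrow> real ^ ('n + 'n) \<Rightarrow> real ^ ('n + 'n) \<Rightarrow> real ^ 'n" where
  "vertical_part g p u = (\<chi> h. u $ Inr h +
     (\<Sum>j\<in>UNIV. u $ Inl j * (\<Sum>k\<in>UNIV. p $ Inr k * christoffel g h k j (base_point p))))"

lemma lift_decomposition:
  "u = horizontal_lift g (\<lambda>_. horizontal_part u) p + vertical_lift (\<lambda>_. vertical_part g p u) p"
proof -
  have "u $ a = (horizontal_lift g (\<lambda>_. horizontal_part u) p +
      vertical_lift (\<lambda>_. vertical_part g p u) p) $ a" for a
    by (cases a) (simp_all add: horizontal_lift_nth vertical_lift_nth horizontal_part_def vertical_part_def)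
  then show ?thesis by (simp add: vec_eq_iff)
qed

lemma parts_of_lifts:
  "horizontal_part (horizontal_lift g X p) = X (base_point p)"
  "vertical_part g p (horizontal_lift g X p) = 0"
  "horizontal_part (vertical_lift X p) = 0"
  "vertical_part g p (vertical_lift X p) = X (base_point p)"
  by (simp_all add: vec_eq_iff horizontal_part_def vertical_part_def horizontal_lift_nth vertical_lift_nth)

lemma linear_horizontal_part: "linear horizontal_part"
  by (rule linearI) (simp_all add: vec_eq_iff horizontal_part_def)

lemma linear_vertical_part: "linear (vertical_part g p)"
  by (rule linearI)
    (simp_all add: vec_eq_iff vertical_part_def algebra_simps sum.distrib sum_distrib_left)

lemma is_sasaki_metric_explicit:
  assumes bil: "\<And>x. bilinear (g x)"
  shows "is_sasaki_metric g (\<lambda>p u v. g (base_point p) (horizontal_part u) (horizontal_part v)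
           + g (base_point p) (vertical_part g p u) (vertical_part g p v))"
proof -
  note hv = linear_horizontal_part[THEN linear_add] linear_horizontal_part[THEN linear_cmul]
    linear_vertical_part[THEN linear_add] linear_vertical_part[THEN linear_cmul]
  have "bilinear (\<lambda>u v. g (base_point p) (horizontal_part u) (horizontal_part v)
           + g (base_point p) (vertical_part g p u) (vertical_part g p v))" for p
    unfolding bilinear_def
    by (intro conjI allI linearI)
      (simp_all add: hv bilinear_ladd[OF bil] bilinear_radd[OF bil] bilinear_lmul[OF bil]
        bilinear_rmul[OF bil] algebra_simps)
  then show ?thesis
    by (simp add: is_sasaki_metric_def parts_of_lifts bilinear_lzero[OF bil] bilinear_rzero[OF bil])
qed

lemma is_sasaki_metric_unique:
  assumes "is_sasaki_metric g G"
  shows "G p u v = g (base_point p) (horizontal_part u) (horizontal_part v)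
           + g (base_point p) (vertical_part g p u) (vertical_part g p v)"
proof -
  have bil: "bilinear (G p)" using assms by (simp add: is_sasaki_metric_def)
  show ?thesis
    apply (subst lift_decomposition[of u g p], subst lift_decomposition[of v g p])
    using assms by (simp add: is_sasaki_metric_def bilinear_ladd[OF bil] bilinear_radd[OF bil])
qed

lemma is_sasaki_metric_ex1:
  assumes "\<And>x. bilinear (g x)"
  shows "\<exists>!G. is_sasaki_metric g G"
proof (rule ex1I, rule is_sasaki_metric_explicit)
  fix G assume "is_sasaki_metric g G"
  then show "G = (\<lambda>p u v. g (base_point p) (horizontal_part u) (horizontal_part v)
           + g (base_point p) (vertical_part g p u) (vertical_part g p v))"
    by (intro ext) (rule is_sasaki_metric_unique)
qed (rule assms)

lemma is_sasaki_metric_sasaki_metric: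
  assumes "\<And>x. bilinear (g x)"
  shows "is_sasaki_metric g (sasaki_metric g)"
  unfolding sasaki_metric_def by (rule theI'[OF is_sasaki_metric_ex1]) (rule assms)

definition heisenberg_metric :: "3 metric" where
  "heisenberg_metric x u v =
     u $ 1 * v $ 1 + u $ 2 * v $ 2
     + (u $ 3 + x $ 2 * u $ 1 - x $ 1 * u $ 2) * (v $ 3 + x $ 2 * v $ 1 - x $ 1 * v $ 2)"

definition E1 :: "3 vfield" where "E1 x = axis 1 1 - x $ 2 *\<^sub>R axis 3 1"
definition E2 :: "3 vfield" where "E2 x = axis 2 1 + x $ 1 *\<^sub>R axis 3 1"
definition E3 :: "3 vfield" where "E3 x = axis 3 1"

lemma bilinear_heisenberg_metric: "bilinear (heisenberg_metric x)"
  unfolding bilinear_def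
  by (intro conjI allI linearI) (simp_all add: heisenberg_metric_def algebra_simps)

lemma heisenberg_metric_sym: "heisenberg_metric x u v = heisenberg_metric x v u"
  by (simp add: heisenberg_metric_def mult.commute)

lemma heisenberg_metric_pos:
  assumes "u \<noteq> 0"
  shows "heisenberg_metric x u u > 0"
proof (rule ccontr)
  assume "\<not> heisenberg_metric x u u > 0"
  then have "(u $ 1)\<^sup>2 + (u $ 2)\<^sup>2 + (u $ 3 + x $ 2 * u $ 1 - x $ 1 * u $ 2)\<^sup>2 \<le> 0"
    by (simp add: heisenberg_metric_def power2_eq_square)
  then have "(u $ 1)\<^sup>2 = 0 \<and> (u $ 2)\<^sup>2 = 0 \<and> (u $ 3 + x $ 2 * u $ 1 - x $ 1 * u $ 2)\<^sup>2 = 0"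
    by (smt (verit) zero_le_power2)
  then have "u = 0" by (auto simp: vec_eq_iff forall_3)
  with assms show False ..
qed

lemma heisenberg_frame_orthonormal:
  "heisenberg_metric x (E1 x) (E1 x) = 1" "heisenberg_metric x (E2 x) (E2 x) = 1"
  "heisenberg_metric x (E3 x) (E3 x) = 1" "heisenberg_metric x (E1 x) (E2 x) = 0"
  "heisenberg_metric x (E1 x) (E3 x) = 0" "heisenberg_metric x (E2 x) (E3 x) = 0"
  by (simp_all add: heisenberg_metric_def E1_def E2_def E3_def axis_def)

abbreviation heisenberg_sasaki :: "(3 + 3) metric" where
  "heisenberg_sasaki \<equiv> sasaki_metric heisenberg_metric"

lemma is_sasaki_metric_heisenberg_sasaki: "is_sasaki_metric heisenberg_metric heisenberg_sasaki"
  by (rule is_sasaki_metric_sasaki_metric) (rule bilinear_heisenberg_metric)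

lemma heisenberg_sasaki_pos:
  assumes "u \<noteq> 0"
  shows "heisenberg_sasaki p u u > 0"
proof -
  let ?g = "heisenberg_metric (base_point p)"
  let ?h = "horizontal_part u" and ?v = "vertical_part heisenberg_metric p u"
  have nonneg: "?g w w \<ge> 0" for w
    by (cases "w = 0")
      (simp_all add: heisenberg_metric_pos less_imp_le bilinear_lzero[OF bilinear_heisenberg_metric])
  have "?h \<noteq> 0 \<or> ?v \<noteq> 0"
  proof (rule ccontr)
    assume "\<not> ?thesis"
    then have "horizontal_part u = 0" "vertical_part heisenberg_metric p u = 0" by simp_all
    then have "u = 0"
      using lift_decomposition[of u heisenberg_metric p]
      by (simp add: horizontal_lift_def vertical_lift_def)
    with assms show False ..
  qed
  then have "?g ?h ?h + ?g ?v ?v > 0"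
    using heisenberg_metric_pos nonneg by (metis add_nonneg_pos add_pos_nonneg)
  then show ?thesis
    by (simp add: is_sasaki_metric_unique[OF is_sasaki_metric_heisenberg_sasaki])
qed

definition F_H :: "(3 + 3) distribution" where
  "F_H = spanned_distribution (horizontal_lift heisenberg_metric E1) (horizontal_lift heisenberg_metric E2)"

definition F_V :: "(3 + 3) distribution" where
  "F_V = spanned_distribution (vertical_lift E1) (vertical_lift E2)"

lemma dim_F_H: "dim (F_H p) = 2"
proof -
  let ?A = "horizontal_lift heisenberg_metric E1 p" and ?B = "horizontal_lift heisenberg_metric E2 p"
  have c: "?A $ Inl 1 = 1" "?A $ Inl 2 = 0" "?B $ Inl 1 = 0" "?B $ Inl 2 = 1"
    by (simp_all add: horizontal_lift_nth E1_def E2_def axis_def)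
  have "?A \<noteq> ?B" using c by force
  moreover have "independent {?A, ?B}"
    using c by (auto simp: independent_insert span_singleton)
  ultimately show ?thesis
    by (simp add: F_H_def spanned_distribution_def dim_eq_card_independent)
qed

lemma dim_F_V: "dim (F_V p) = 2"
proof -
  let ?A = "vertical_lift E1 p" and ?B = "vertical_lift E2 p"
  have c: "?A $ Inr 1 = 1" "?A $ Inr 2 = 0" "?B $ Inr 1 = 0" "?B $ Inr 2 = 1"
    by (simp_all add: vertical_lift_nth E1_def E2_def axis_def)
  have "?A \<noteq> ?B" using c by force
  moreover have "independent {?A, ?B}"
    using c by (auto simp: independent_insert span_singleton)
  ultimately show ?thesis
    by (simp add: F_V_def spanned_distribution_def dim_eq_card_independent)
qed

end

theory Submission imports Defs
begin

text \<open>Along a geodesic of the Sasaki metric with base curve \<open>x\<close> and fibre curve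
  \<open>y\<close>, the vector \<open>z = D y\<close> is parallel along \<open>x\<close>, and
  \<open>D x' = - R(y, z) x'\<close> up to the sign convention. If the geodesic is tangent to
  \<open>F_H\<close> at one point, then \<open>z = 0\<close> everywhere and \<open>x\<close> is a
  geodesic, whose inner product with the Killing field \<open>E3\<close> is constant. If it is
  tangent to \<open>F_V\<close> at one point, then \<open>x' = 0\<close> there, and hence
  everywhere, since the equation for \<open>x'\<close> is a rotation; the fibre curve is then a
  straight line. Neither distribution is isocline, as two explicit geodesics show: for
  \<open>F_V\<close> a horizontal line with \<open>y = s z\<close>, for \<open>F_H\<close> a
  trigonometric solution on which the curvature term does not vanish.\<close>

subsection \<open>Geodesics in an orthonormal coframe\<close>

text \<open>This is the product rule. Here \<open>D p v u\<close> is the derivative of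
  \<open>\<Theta> p u\<close> in the point, in direction \<open>v\<close>, with the vector
  \<open>u\<close> held constant.\<close>

lemma partial_deriv_metric_coeff:
  fixes g :: "('n::finite) metric" and \<Theta> :: "real ^ 'n \<Rightarrow> real ^ 'n \<Rightarrow> 'a::real_inner"
  assumes g: "\<And>p u v. g p u v = \<Theta> p u \<bullet> \<Theta> p v"
    and der: "\<And>p u. ((\<lambda>p. \<Theta> p u) has_derivative (\<lambda>v. D p v u)) (at p)"
  shows "partial_deriv k (metric_coeff g i j) p =
    D p (axis k 1) (axis i 1) \<bullet> \<Theta> p (axis j 1) + \<Theta> p (axis i 1) \<bullet> D p (axis k 1) (axis j 1)"
proof -
  have lin: "linear (\<lambda>v. D p v u)" for u
    using der[of u p] by (rule has_derivative_linear)
  have d: "((\<lambda>t. \<Theta> (p + t *\<^sub>R axis k 1) u) has_derivative (\<lambda>t. t *\<^sub>R D p (axis k 1) u)) (at 0)" for u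
  proof -
    have "((\<lambda>t. p + t *\<^sub>R axis k 1) has_derivative (\<lambda>t. t *\<^sub>R axis k 1)) (at (0::real))"
      by (auto intro!: derivative_eq_intros)
    from has_derivative_compose[OF this, of "\<lambda>p. \<Theta> p u" "\<lambda>v. D p v u"] der[of u p]
    show ?thesis by (simp add: linear_cmul[OF lin])
  qed
  have "((\<lambda>t. metric_coeff g i j (p + t *\<^sub>R axis k 1)) has_derivative
      (\<lambda>t. \<Theta> p (axis i 1) \<bullet> (t *\<^sub>R D p (axis k 1) (axis j 1)) +
        (t *\<^sub>R D p (axis k 1) (axis i 1)) \<bullet> \<Theta> p (axis j 1))) (at 0)"
    unfolding metric_coeff_def g using has_derivative_inner[OF d d, of "axis i 1" "axis j 1"] by simp
  then have "((\<lambda>t. metric_coeff g i j (p + t *\<^sub>R axis k 1)) has_field_derivative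
      (D p (axis k 1) (axis i 1) \<bullet> \<Theta> p (axis j 1) + \<Theta> p (axis i 1) \<bullet> D p (axis k 1) (axis j 1))) (at 0)"
    unfolding has_field_derivative_def
    by (rule has_derivative_eq_rhs) (simp add: fun_eq_iff algebra_simps)
  then show ?thesis
    unfolding partial_deriv_def by (rule DERIV_imp_deriv)
qed

section \<open>Expansions in the coordinate basis and Christoffel symbols\<close>

lemma axis_expansion: "(\<Sum>i\<in>UNIV. (v $ i) *\<^sub>R axis i 1) = (v :: real ^ 'n::finite)"
  using basis_expansion[of v] by (simp add: scalar_mult_eq_scaleR)

lemma linear_axis_expansion:
  fixes f :: "real ^ 'n::finite \<Rightarrow> 'a::real_vector"
  assumes "linear f"
  shows "f v = (\<Sum>i\<in>UNIV. (v $ i) *\<^sub>R f (axis i 1))"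
  by (subst (1) axis_expansion[symmetric]) (simp only: linear_sum[OF assms] linear_cmul[OF assms])

lemma bilinear_axis_expansion:
  fixes h :: "real ^ 'n::finite \<Rightarrow> real ^ 'm::finite \<Rightarrow> real"
  assumes "bilinear h"
  shows "(\<Sum>k\<in>UNIV. \<Sum>j\<in>UNIV. v $ k * w $ j * h (axis k 1) (axis j 1)) = h v w"
proof -
  have "h v w = (\<Sum>k\<in>UNIV. v $ k * h (axis k 1) w)"
    using linear_axis_expansion[of "\<lambda>x. h x w" v] assms by (simp add: bilinear_def)
  also have "\<dots> = (\<Sum>k\<in>UNIV. v $ k * (\<Sum>j\<in>UNIV. w $ j * h (axis k 1) (axis j 1)))"
    using linear_axis_expansion[of "h _" w] assms by (simp add: bilinear_def)
  finally show ?thesis by (simp add: sum_distrib_left mult.assoc)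
qed

lemma matrix_vector_mult_metric_coeff:
  fixes g :: "('n::finite) metric"
  assumes "bilinear (g p)"
  shows "((\<chi> k l. metric_coeff g k l p) *v v) $ i = g p (axis i 1) v"
  using linear_axis_expansion[of "g p (axis i 1)" v] assms
  by (simp add: bilinear_def matrix_vector_mult_def metric_coeff_def mult.commute)

text \<open>Positive definiteness gives the Gram matrix a trivial kernel, so it is invertible, and
  the choice in \<open>matrix_inv\<close> then returns an inverse.\<close>

lemma inverse_coeff_right_inverse:
  fixes g :: "('n::finite) metric"
  assumes bil: "bilinear (g p)" and pos: "\<And>u. u \<noteq> 0 \<Longrightarrow> g p u u > 0"
  shows "(\<Sum>h\<in>UNIV. metric_coeff g m h p * inverse_coeff g h l p) = (if m = l then 1 else 0)"
proof -
  let ?G = "\<chi> k l. metric_coeff g k l p"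
  have "x = 0" if "?G *v x = 0" for x
  proof (rule ccontr)
    assume "x \<noteq> 0"
    have "g p x x = (\<Sum>j\<in>UNIV. x $ j * g p (axis j 1) x)"
      using linear_axis_expansion[of "\<lambda>z. g p z x" x] bil by (simp add: bilinear_def)
    also have "\<dots> = 0"
      using that matrix_vector_mult_metric_coeff[of g p x, OF bil] by (simp add: vec_eq_iff)
    finally show False using pos[OF \<open>x \<noteq> 0\<close>] by simp
  qed
  then have "invertible ?G"
    by (meson invertible_left_inverse matrix_left_invertible_ker)
  then have "?G ** matrix_inv ?G = mat 1"
    unfolding invertible_def matrix_inv_def by (rule someI2_ex) blast
  then have "(?G ** matrix_inv ?G) $ m $ l = (mat 1 :: real ^ 'n ^ 'n) $ m $ l" by simp
  then show ?thesis
    by (simp add: matrix_matrix_mult_def inverse_coeff_def mat_def)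
qed

text \<open>Contraction with the metric cancels its inverse and leaves the Christoffel symbols of
  the first kind. The inverse of the six-dimensional Sasaki metric therefore never has to be
  computed.\<close>

lemma christoffel_lowered:
  fixes g :: "('n::finite) metric"
  assumes bil: "bilinear (g p)" and pos: "\<And>u. u \<noteq> 0 \<Longrightarrow> g p u u > 0"
  shows "(\<Sum>h\<in>UNIV. metric_coeff g m h p * christoffel g h k j p) =
    1 / 2 * (partial_deriv k (metric_coeff g m j) p + partial_deriv j (metric_coeff g m k) p
        - partial_deriv m (metric_coeff g k j) p)"
proof -
  define B where "B l = partial_deriv k (metric_coeff g l j) p + partial_deriv j (metric_coeff g l k) p
        - partial_deriv l (metric_coeff g k j) p" for l
  have "(\<Sum>h\<in>UNIV. metric_coeff g m h p * christoffel g h k j p) =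
      1 / 2 * (\<Sum>h\<in>UNIV. \<Sum>l\<in>UNIV. metric_coeff g m h p * inverse_coeff g h l p * B l)"
    by (simp add: christoffel_def B_def sum_distrib_left mult_ac)
  also have "\<dots> = 1 / 2 * (\<Sum>l\<in>UNIV. (\<Sum>h\<in>UNIV. metric_coeff g m h p * inverse_coeff g h l p) * B l)"
    by (subst sum.swap) (simp add: sum_distrib_right)
  also have "\<dots> = 1 / 2 * B m"
    by (simp add: inverse_coeff_right_inverse[of g p, OF assms] if_distrib[where f="\<lambda>x. x * _"] cong: if_cong)
  finally show ?thesis by (simp add: B_def)
qed

text \<open>Both sides are linear in \<open>u\<close>, so basis vectors suffice. After contraction
  with \<open>w\<close> twice, the first two metric derivatives agree, and in each of the three the
  product rule yields terms that absorb the factor 1/2.\<close>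

lemma inner_christoffel_term:
  fixes g :: "('n::finite) metric" and \<Theta> :: "real ^ 'n \<Rightarrow> real ^ 'n \<Rightarrow> 'a::real_inner"
  assumes g: "\<And>p u v. g p u v = \<Theta> p u \<bullet> \<Theta> p v"
    and lin: "\<And>p. linear (\<Theta> p)" and inj: "\<And>p. inj (\<Theta> p)"
    and der: "\<And>p u. ((\<lambda>p. \<Theta> p u) has_derivative (\<lambda>v. D p v u)) (at p)"
    and linD: "\<And>p v. linear (D p v)"
  shows "\<Theta> p u \<bullet> \<Theta> p (\<chi> h. \<Sum>k\<in>UNIV. \<Sum>j\<in>UNIV. christoffel g h k j p * w $ k * w $ j) =
    \<Theta> p u \<bullet> D p w w + \<Theta> p w \<bullet> (D p w u - D p u w)"
proof -
  have bil: "bilinear (g p)"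
    unfolding bilinear_def g
    by (intro conjI allI linearI) (simp_all add: linear_add[OF lin] linear_cmul[OF lin] inner_simps)
  have pos: "g p u u > 0" if "u \<noteq> 0" for u
    using that inj[of p] by (auto simp: g linear_injective_0[OF lin])
  have linD': "linear (\<lambda>v. D p v u)" for u
    using der[of u p] by (rule has_derivative_linear)
  let ?e = "\<lambda>i. axis i 1 :: real ^ 'n"
  let ?c = "\<chi> h. \<Sum>k\<in>UNIV. \<Sum>j\<in>UNIV. christoffel g h k j p * w $ k * w $ j"
  have tw: "\<Theta> p w = (\<Sum>i\<in>UNIV. (w $ i) *\<^sub>R \<Theta> p (?e i))"
    by (rule linear_axis_expansion[OF lin])
  have Dw: "D p w x = (\<Sum>i\<in>UNIV. (w $ i) *\<^sub>R D p (?e i) x)" for x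
    by (rule linear_axis_expansion[OF linD'])
  have Dw2: "D p x w = (\<Sum>i\<in>UNIV. (w $ i) *\<^sub>R D p x (?e i))" for x
    by (rule linear_axis_expansion[OF linD])
  have lowered: "(\<Sum>h\<in>UNIV. metric_coeff g m h p * christoffel g h k j p) =
    1 / 2 * (partial_deriv k (metric_coeff g m j) p + partial_deriv j (metric_coeff g m k) p
        - partial_deriv m (metric_coeff g k j) p)" for m k j
    by (rule christoffel_lowered) (fact bil, erule pos)
  have basis: "\<Theta> p (?e m) \<bullet> \<Theta> p ?c =
     \<Theta> p (?e m) \<bullet> D p w w + \<Theta> p w \<bullet> (D p w (?e m) - D p (?e m) w)" for m
  proof -
    have "\<Theta> p (?e m) \<bullet> \<Theta> p ?c = (\<Sum>h\<in>UNIV. metric_coeff g m h p * ?c $ h)"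
      using matrix_vector_mult_metric_coeff[of g p ?c m, OF bil]
      by (simp only: g matrix_vector_mult_def vec_lambda_beta)
    also have "\<dots> = (\<Sum>h\<in>UNIV. \<Sum>k\<in>UNIV. \<Sum>j\<in>UNIV.
        w $ k * w $ j * (metric_coeff g m h p * christoffel g h k j p))"
      by (simp add: sum_distrib_left mult_ac)
    also have "\<dots> = (\<Sum>k\<in>UNIV. \<Sum>h\<in>UNIV. \<Sum>j\<in>UNIV.
        w $ k * w $ j * (metric_coeff g m h p * christoffel g h k j p))"
      by (rule sum.swap)
    also have "\<dots> = (\<Sum>k\<in>UNIV. \<Sum>j\<in>UNIV. \<Sum>h\<in>UNIV.
        w $ k * w $ j * (metric_coeff g m h p * christoffel g h k j p))"
      by (intro sum.cong refl sum.swap)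
    also have "\<dots> = (\<Sum>k\<in>UNIV. \<Sum>j\<in>UNIV. w $ k * w $ j *
        (1 / 2 * (partial_deriv k (metric_coeff g m j) p + partial_deriv j (metric_coeff g m k) p
        - partial_deriv m (metric_coeff g k j) p)))"
      by (simp only: sum_distrib_left[symmetric] lowered)
    also have "\<dots> = 1 / 2 * (\<Sum>k\<in>UNIV. \<Sum>j\<in>UNIV. w $ k * w $ j * (
        (D p (?e k) (?e m) \<bullet> \<Theta> p (?e j) + \<Theta> p (?e m) \<bullet> D p (?e k) (?e j)) +
        (D p (?e j) (?e m) \<bullet> \<Theta> p (?e k) + \<Theta> p (?e m) \<bullet> D p (?e j) (?e k)) -
        (D p (?e m) (?e k) \<bullet> \<Theta> p (?e j) + \<Theta> p (?e k) \<bullet> D p (?e m) (?e j))))"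
      by (simp add: partial_deriv_metric_coeff[of g \<Theta> D, OF g der] sum_distrib_left mult_ac)
    also have "\<dots> = 1 / 2 * (
        (D p w (?e m) \<bullet> \<Theta> p w + \<Theta> p (?e m) \<bullet> D p w w) +
        (D p w (?e m) \<bullet> \<Theta> p w + \<Theta> p (?e m) \<bullet> D p w w) -
        (D p (?e m) w \<bullet> \<Theta> p w + \<Theta> p w \<bullet> D p (?e m) w))"
    proof -
      note expand = bilinear_axis_expansion[of _ w w]
      note linears = linear_add[OF lin] linear_cmul[OF lin] linear_add[OF linD] linear_cmul[OF linD]
        linear_add[OF linD'] linear_cmul[OF linD']
      have "(\<Sum>k\<in>UNIV. \<Sum>j\<in>UNIV. w $ k * w $ j * (D p (?e k) (?e m) \<bullet> \<Theta> p (?e j))) = D p w (?e m) \<bullet> \<Theta> p w"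
        by (rule expand[of "\<lambda>a b. D p a (?e m) \<bullet> \<Theta> p b"])
          (auto simp: bilinear_def linears inner_simps intro!: linearI)
      moreover have "(\<Sum>k\<in>UNIV. \<Sum>j\<in>UNIV. w $ k * w $ j * (\<Theta> p (?e m) \<bullet> D p (?e k) (?e j))) = \<Theta> p (?e m) \<bullet> D p w w"
        by (rule expand[of "\<lambda>a b. \<Theta> p (?e m) \<bullet> D p a b"])
          (auto simp: bilinear_def linears inner_simps intro!: linearI)
      moreover have "(\<Sum>k\<in>UNIV. \<Sum>j\<in>UNIV. w $ k * w $ j * (D p (?e j) (?e m) \<bullet> \<Theta> p (?e k))) = D p w (?e m) \<bullet> \<Theta> p w"
        by (rule expand[of "\<lambda>a b. D p b (?e m) \<bullet> \<Theta> p a"])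
          (auto simp: bilinear_def linears inner_simps intro!: linearI)
      moreover have "(\<Sum>k\<in>UNIV. \<Sum>j\<in>UNIV. w $ k * w $ j * (\<Theta> p (?e m) \<bullet> D p (?e j) (?e k))) = \<Theta> p (?e m) \<bullet> D p w w"
        by (rule expand[of "\<lambda>a b. \<Theta> p (?e m) \<bullet> D p b a"])
          (auto simp: bilinear_def linears inner_simps intro!: linearI)
      moreover have "(\<Sum>k\<in>UNIV. \<Sum>j\<in>UNIV. w $ k * w $ j * (D p (?e m) (?e k) \<bullet> \<Theta> p (?e j))) = D p (?e m) w \<bullet> \<Theta> p w"
        by (rule expand[of "\<lambda>a b. D p (?e m) a \<bullet> \<Theta> p b"])
          (auto simp: bilinear_def linears inner_simps intro!: linearI)
      moreover have "(\<Sum>k\<in>UNIV. \<Sum>j\<in>UNIV. w $ k * w $ j * (\<Theta> p (?e k) \<bullet> D p (?e m) (?e j))) = \<Theta> p w \<bullet> D p (?e m) w"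
        by (rule expand[of "\<lambda>a b. \<Theta> p a \<bullet> D p (?e m) b"])
          (auto simp: bilinear_def linears inner_simps intro!: linearI)
      ultimately show ?thesis
        by (simp only: distrib_left right_diff_distrib sum.distrib sum_subtractf)
    qed
    finally show ?thesis by (simp add: inner_commute algebra_simps)
  qed
  have eq: "linear (\<lambda>u. \<Theta> p u \<bullet> \<Theta> p ?c - (\<Theta> p u \<bullet> D p w w + \<Theta> p w \<bullet> (D p w u - D p u w)))" (is "linear ?f")
    by (rule linearI) (simp_all add: linear_add[OF lin] linear_cmul[OF lin] linear_add[OF linD]
      linear_cmul[OF linD] linear_add[OF linD'] linear_cmul[OF linD'] inner_simps algebra_simps)
  have "?f u = (\<Sum>i\<in>UNIV. (u $ i) *\<^sub>R ?f (?e i))"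
    by (rule linear_axis_expansion[OF eq])
  also have "\<dots> = 0" by (simp add: basis)
  finally show ?thesis by simp
qed

text \<open>With the orthonormal coframe \<open>\<Theta>\<close>, these are the Euler--Lagrange equations
  of the energy: the term \<open>D v u - D u v\<close> is the exterior derivative of
  \<open>\<Theta>\<close>.\<close>

theorem geodesic_on_coframe:
  fixes g :: "('n::finite) metric" and \<Theta> :: "real ^ 'n \<Rightarrow> real ^ 'n \<Rightarrow> 'a::real_inner"
  assumes g: "\<And>p u v. g p u v = \<Theta> p u \<bullet> \<Theta> p v"
    and lin: "\<And>p. linear (\<Theta> p)" and inj: "\<And>p. inj (\<Theta> p)"
    and der: "\<And>p u. ((\<lambda>p. \<Theta> p u) has_derivative (\<lambda>v. D p v u)) (at p)"
    and linD: "\<And>p v. linear (D p v)"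
  shows "geodesic_on g J \<gamma> \<longleftrightarrow> open J \<and> is_interval J \<and>
    (\<forall>t\<in>J. \<gamma> differentiable (at t) \<and> velocity \<gamma> differentiable (at t) \<and>
      (\<forall>u. \<Theta> (\<gamma> t) u \<bullet> (\<Theta> (\<gamma> t) (velocity (velocity \<gamma>) t) + D (\<gamma> t) (velocity \<gamma> t) (velocity \<gamma> t)) +
        \<Theta> (\<gamma> t) (velocity \<gamma> t) \<bullet> (D (\<gamma> t) (velocity \<gamma> t) u - D (\<gamma> t) u (velocity \<gamma> t)) = 0))"
proof -
  have "(\<forall>h. a $ h + (\<Sum>k\<in>UNIV. \<Sum>j\<in>UNIV. christoffel g h k j p * w $ k * w $ j) = 0) \<longleftrightarrow>
    (\<forall>u. \<Theta> p u \<bullet> (\<Theta> p a + D p w w) + \<Theta> p w \<bullet> (D p w u - D p u w) = 0)" (is "?L \<longleftrightarrow> ?R") for a w p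
  proof -
    let ?c = "\<chi> h. \<Sum>k\<in>UNIV. \<Sum>j\<in>UNIV. christoffel g h k j p * w $ k * w $ j"
    have "\<Theta> p u \<bullet> \<Theta> p (a + ?c) = \<Theta> p u \<bullet> (\<Theta> p a + D p w w) + \<Theta> p w \<bullet> (D p w u - D p u w)" for u
      by (simp only: linear_add[OF lin] inner_add_right
        inner_christoffel_term[of g \<Theta> D, OF g lin inj der linD] add.assoc)
    then have "?R \<longleftrightarrow> (\<forall>u. \<Theta> p u \<bullet> \<Theta> p (a + ?c) = 0)" by simp
    also have "\<dots> \<longleftrightarrow> a + ?c = 0"
    proof
      assume "\<forall>u. \<Theta> p u \<bullet> \<Theta> p (a + ?c) = 0"
      \<comment> \<open>The covariant acceleration is tested against itself.\<close>
      then have "\<Theta> p (a + ?c) \<bullet> \<Theta> p (a + ?c) = 0" by (rule spec)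
      then have "\<Theta> p (a + ?c) = 0" by (simp only: inner_eq_zero_iff)
      then show "a + ?c = 0" using inj[of p] by (simp only: linear_injective_0[OF lin])
    next
      assume "a + ?c = 0"
      then show "\<forall>u. \<Theta> p u \<bullet> \<Theta> p (a + ?c) = 0" by (simp only: linear_0[OF lin] inner_zero_right simp_thms)
    qed
    also have "\<dots> \<longleftrightarrow> ?L" by (simp add: vec_eq_iff)
    finally show ?thesis by simp
  qed
  then show ?thesis unfolding geodesic_on_def by simp
qed

text \<open>The derivative of \<open>\<Theta> p u\<close> is given for fixed \<open>u\<close>; the
  moving vector \<open>c s\<close> is expanded in the basis and the product rule applied to each
  summand.\<close>

lemma has_vector_derivative_coframe:
  fixes \<Theta> :: "'b::real_normed_vector \<Rightarrow> real ^ 'n::finite \<Rightarrow> 'a::real_normed_vector"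
  assumes lin: "\<And>p. linear (\<Theta> p)"
    and der: "\<And>p u. ((\<lambda>p. \<Theta> p u) has_derivative (\<lambda>v. D p v u)) (at p)"
    and linD: "\<And>p v. linear (D p v)"
    and \<gamma>: "(\<gamma> has_vector_derivative w) (at t)" and c: "(c has_vector_derivative a) (at t)"
  shows "((\<lambda>s. \<Theta> (\<gamma> s) (c s)) has_vector_derivative (\<Theta> (\<gamma> t) a + D (\<gamma> t) w (c t))) (at t)"
proof -
  have 1: "((\<lambda>s. \<Theta> (\<gamma> s) u) has_vector_derivative D (\<gamma> t) w u) (at t)" for u
    using vector_derivative_diff_chain_within[OF \<gamma>, of "\<lambda>p. \<Theta> p u" "\<lambda>v. D (\<gamma> t) v u"]
      has_derivative_at_withinI[OF der] by (simp add: o_def)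
  have 2: "((\<lambda>s. c s $ i) has_vector_derivative a $ i) (at t)" for i
    using bounded_linear.has_vector_derivative[OF bounded_linear_vec_nth c] .
  have "((\<lambda>s. \<Sum>i\<in>UNIV. (c s $ i) *\<^sub>R \<Theta> (\<gamma> s) (axis i 1)) has_vector_derivative
      (\<Sum>i\<in>UNIV. (c t $ i) *\<^sub>R D (\<gamma> t) w (axis i 1) + (a $ i) *\<^sub>R \<Theta> (\<gamma> t) (axis i 1))) (at t)"
    by (intro has_vector_derivative_sum has_vector_derivative_scaleR 1
      has_real_derivative_iff_has_vector_derivative[THEN iffD2] 2)
  then show ?thesis
    by (simp add: sum.distrib linear_axis_expansion[OF lin, symmetric] linear_axis_expansion[OF linD, symmetric] add.commute)
qed

subsection \<open>The Sasaki coframe of the Heisenberg manifold\<close>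

lemma matrix_inv_eqI:
  fixes A B :: "real ^ 'n::finite ^ 'n"
  assumes "A ** B = mat 1"
  shows "matrix_inv A = B"
proof -
  have BA: "B ** A = mat 1" using assms by (simp add: matrix_left_right_inverse)
  have "A ** matrix_inv A = mat 1 \<and> matrix_inv A ** A = mat 1"
    unfolding matrix_inv_def by (rule someI[of _ B]) (simp add: assms BA)
  then have "matrix_inv A = matrix_inv A ** (A ** B)" by (simp add: assms)
  also have "\<dots> = B" using \<open>_ \<and> _\<close> by (simp add: matrix_mul_assoc)
  finally show ?thesis .
qed

lemma vec3_eq_iff: "v = w \<longleftrightarrow> v $ 1 = w $ 1 \<and> v $ 2 = w $ 2 \<and> v $ 3 = w $ 3" for v w :: "'a ^ 3"
  by (simp add: vec_eq_iff forall_3)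

lemma inner_vec3: "v \<bullet> w = v $ 1 * w $ 1 + v $ 2 * w $ 2 + v $ 3 * w $ 3" for v w :: "real ^ 3"
  by (simp add: inner_vec_def sum_3)

lemma has_derivative_vector_3:
  fixes f1 f2 f3 :: "'a::real_normed_vector \<Rightarrow> real"
  assumes "(f1 has_derivative d1) F" "(f2 has_derivative d2) F" "(f3 has_derivative d3) F"
  shows "((\<lambda>x. vector [f1 x, f2 x, f3 x] :: real ^ 3) has_derivative (\<lambda>v. vector [d1 v, d2 v, d3 v])) F"
proof -
  have *: "(vector [a, b, c] :: real ^ 3) = a *\<^sub>R axis 1 1 + b *\<^sub>R axis 2 1 + c *\<^sub>R axis 3 1" for a b c
    by (simp add: vec3_eq_iff axis_def)
  show ?thesis
    unfolding * by (intro has_derivative_add has_derivative_scaleR_left assms)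
qed

lemma has_derivative_vec_nth: "((\<lambda>v. v $ i) has_derivative (\<lambda>v. v $ i)) F"
  for F :: "(real ^ 'n::finite) filter"
  by (rule bounded_linear_imp_has_derivative) (rule bounded_linear_vec_nth)

text \<open>The components of \<open>a\<close> in the frame \<open>E1, E2, E3\<close>, given by the
  dual coframe; the third entry is a contact form.\<close>

definition heis_coframe :: "real ^ 3 \<Rightarrow> real ^ 3 \<Rightarrow> real ^ 3" where
  "heis_coframe x a = vector [a $ 1, a $ 2, a $ 3 + x $ 2 * a $ 1 - x $ 1 * a $ 2]"

definition heis_coframe_deriv :: "real ^ 3 \<Rightarrow> real ^ 3 \<Rightarrow> real ^ 3 \<Rightarrow> real ^ 3" where
  "heis_coframe_deriv x v a = vector [0, 0, v $ 2 * a $ 1 - v $ 1 * a $ 2]"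

lemma heis_coframe_nth [simp]:
  "heis_coframe x a $ 1 = a $ 1" "heis_coframe x a $ 2 = a $ 2"
  "heis_coframe x a $ 3 = a $ 3 + x $ 2 * a $ 1 - x $ 1 * a $ 2"
  by (simp_all add: heis_coframe_def)

lemma heisenberg_metric_coframe: "heisenberg_metric x u v = heis_coframe x u \<bullet> heis_coframe x v"
  by (simp add: heisenberg_metric_def inner_vec3)

lemma heis_coframe_has_derivative:
  "((\<lambda>x. heis_coframe x a) has_derivative (\<lambda>v. heis_coframe_deriv x v a)) (at x)"
  unfolding heis_coframe_def heis_coframe_deriv_def
  by (auto intro!: has_derivative_vector_3 derivative_eq_intros has_derivative_vec_nth)

lemma axis_nth_3 [simp]:
  "axis (1::3) (1::real) $ 1 = 1" "axis (1::3) (1::real) $ 2 = 0" "axis (1::3) (1::real) $ 3 = 0"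
  "axis (2::3) (1::real) $ 1 = 0" "axis (2::3) (1::real) $ 2 = 1" "axis (2::3) (1::real) $ 3 = 0"
  "axis (3::3) (1::real) $ 1 = 0" "axis (3::3) (1::real) $ 2 = 0" "axis (3::3) (1::real) $ 3 = 1"
  by (simp_all add: axis_def)

section \<open>The Levi-Civita connection of the base\<close>

lemma partial_deriv_heisenberg:
  "partial_deriv k (metric_coeff heisenberg_metric i j) x =
    heis_coframe_deriv x (axis k 1) (axis i 1) \<bullet> heis_coframe x (axis j 1) +
    heis_coframe x (axis i 1) \<bullet> heis_coframe_deriv x (axis k 1) (axis j 1)"
  by (rule partial_deriv_metric_coeff[OF heisenberg_metric_coframe heis_coframe_has_derivative])

text \<open>The matrix is the sum of the outer products of the orthonormal frame vectors
  \<open>E1 x\<close>, \<open>E2 x\<close>, \<open>E3 x\<close> with themselves.\<close>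

lemma inverse_coeff_heisenberg:
  "inverse_coeff heisenberg_metric i j x =
    vector [vector [1, 0, - x $ 2], vector [0, 1, x $ 1],
      vector [- x $ 2, x $ 1, 1 + (x $ 1)\<^sup>2 + (x $ 2)\<^sup>2] :: real ^ 3] $ i $ j"
proof -
  have "(\<chi> k l. metric_coeff heisenberg_metric k l x) ** (vector [vector [1, 0, - x $ 2], vector [0, 1, x $ 1],
      vector [- x $ 2, x $ 1, 1 + (x $ 1)\<^sup>2 + (x $ 2)\<^sup>2] :: real ^ 3] :: real ^ 3 ^ 3) = mat 1"
    by (simp add: vec3_eq_iff matrix_matrix_mult_def sum_3 metric_coeff_def heisenberg_metric_def mat_def
      algebra_simps power2_eq_square)
  then show ?thesis unfolding inverse_coeff_def by (simp add: matrix_inv_eqI)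
qed

text \<open>The left side is the connection term in the derivative of \<open>y\<close> along
  \<open>a\<close>. It is a combination of \<open>E1\<close> and \<open>E2\<close> alone: the third
  entry is the one for which the contact form vanishes.\<close>

lemma christoffel_heisenberg:
  fixes x y a :: "real ^ 3"
  defines "\<phi> \<equiv> heis_coframe x a" and "\<eta> \<equiv> heis_coframe x y"
  shows "(\<Sum>j\<in>UNIV. a $ j * (\<Sum>k\<in>UNIV. y $ k * christoffel heisenberg_metric h k j x)) =
    vector [\<phi> $ 2 * \<eta> $ 3 + \<phi> $ 3 * \<eta> $ 2, - \<phi> $ 3 * \<eta> $ 1 - \<phi> $ 1 * \<eta> $ 3,
      - x $ 2 * (\<phi> $ 2 * \<eta> $ 3 + \<phi> $ 3 * \<eta> $ 2) - x $ 1 * (\<phi> $ 3 * \<eta> $ 1 + \<phi> $ 1 * \<eta> $ 3) :: real] $ h"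
  unfolding \<phi>_def \<eta>_def using exhaust_3[of h]
  by (elim disjE; simp add: sum_3 christoffel_def partial_deriv_heisenberg inverse_coeff_heisenberg
    heis_coframe_deriv_def inner_vec3) (simp_all add: field_simps power2_eq_square)

text \<open>For a tangent vector \<open>u\<close> of the tangent bundle at \<open>p\<close>, \<open>hor p
  u\<close> and \<open>ver p u\<close> are the components of its horizontal and vertical parts in
  the frame \<open>E1, E2, E3\<close>; \<open>fib p\<close> are the components of the point
  \<open>p\<close> itself, viewed as a tangent vector of the base.\<close>

definition hor :: "real ^ (3 + 3) \<Rightarrow> real ^ (3 + 3) \<Rightarrow> real ^ 3" where
  "hor p u = vector [u $ Inl 1, u $ Inl 2, u $ Inl 3 + p $ Inl 2 * u $ Inl 1 - p $ Inl 1 * u $ Inl 2]"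

definition fib :: "real ^ (3 + 3) \<Rightarrow> real ^ 3" where
  "fib p = vector [p $ Inr 1, p $ Inr 2, p $ Inr 3 + p $ Inl 2 * p $ Inr 1 - p $ Inl 1 * p $ Inr 2]"

definition ver :: "real ^ (3 + 3) \<Rightarrow> real ^ (3 + 3) \<Rightarrow> real ^ 3" where
  "ver p u = vector [
     u $ Inr 1 + hor p u $ 2 * fib p $ 3 + hor p u $ 3 * fib p $ 2,
     u $ Inr 2 - hor p u $ 3 * fib p $ 1 - hor p u $ 1 * fib p $ 3,
     u $ Inr 3 + p $ Inl 2 * u $ Inr 1 - p $ Inl 1 * u $ Inr 2]"

text \<open>This ties the explicit formulas to the parts defined through Christoffel symbols. The
  third entry of \<open>ver\<close> carries no connection term because that term has no
  \<open>E3\<close> component.\<close>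

lemma heis_coframe_parts:
  "heis_coframe (base_point p) (horizontal_part u) = hor p u"
  "heis_coframe (base_point p) (vertical_part heisenberg_metric p u) = ver p u"
proof -
  show h: "heis_coframe (base_point p) (horizontal_part u) = hor p u"
    by (simp add: vec3_eq_iff hor_def base_point_def horizontal_part_def)
  have e: "heis_coframe (base_point p) (\<chi> k. p $ Inr k) = fib p"
    by (simp add: vec3_eq_iff fib_def base_point_def)
  have "vertical_part heisenberg_metric p u $ i = u $ Inr i +
      (\<Sum>j\<in>UNIV. horizontal_part u $ j * (\<Sum>k\<in>UNIV. (\<chi> k. p $ Inr k) $ k *
         christoffel heisenberg_metric i k j (base_point p)))" for i
    by (simp add: vertical_part_def horizontal_part_def)
  then show "heis_coframe (base_point p) (vertical_part heisenberg_metric p u) = ver p u"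
    unfolding christoffel_heisenberg h e
    by (simp add: vec3_eq_iff ver_def base_point_def algebra_simps)
qed

lemma heisenberg_sasaki_eq: "heisenberg_sasaki p u v = hor p u \<bullet> hor p v + ver p u \<bullet> ver p v"
  by (simp add: is_sasaki_metric_unique[OF is_sasaki_metric_heisenberg_sasaki]
    heisenberg_metric_coframe heis_coframe_parts)

section \<open>Derivatives of the Sasaki coframe and its structure equation\<close>

definition hor_deriv :: "real ^ (3 + 3) \<Rightarrow> real ^ (3 + 3) \<Rightarrow> real ^ 3" where
  "hor_deriv v u = vector [0, 0, v $ Inl 2 * u $ Inl 1 - v $ Inl 1 * u $ Inl 2]"

definition fib_deriv :: "real ^ (3 + 3) \<Rightarrow> real ^ (3 + 3) \<Rightarrow> real ^ 3" where
  "fib_deriv p v = vector [v $ Inr 1, v $ Inr 2,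
     v $ Inr 3 + v $ Inl 2 * p $ Inr 1 + p $ Inl 2 * v $ Inr 1 - v $ Inl 1 * p $ Inr 2 - p $ Inl 1 * v $ Inr 2]"

text \<open>The derivative in the point \<open>p\<close> along \<open>v\<close>, with
  \<open>u\<close> held fixed. Only the third entry of \<open>hor p u\<close> depends on
  \<open>p\<close>, so only that entry of \<open>hor_deriv\<close> occurs.\<close>

definition ver_deriv :: "real ^ (3 + 3) \<Rightarrow> real ^ (3 + 3) \<Rightarrow> real ^ (3 + 3) \<Rightarrow> real ^ 3" where
  "ver_deriv p v u = vector [
     hor p u $ 2 * fib_deriv p v $ 3 + hor_deriv v u $ 3 * fib p $ 2 + hor p u $ 3 * fib_deriv p v $ 2,
     - hor_deriv v u $ 3 * fib p $ 1 - hor p u $ 3 * fib_deriv p v $ 1 - hor p u $ 1 * fib_deriv p v $ 3,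
     v $ Inl 2 * u $ Inr 1 - v $ Inl 1 * u $ Inr 2]"

lemma hor_has_derivative: "((\<lambda>p. hor p u) has_derivative (\<lambda>v. hor_deriv v u)) (at p)"
  unfolding hor_def hor_deriv_def
  by (auto intro!: has_derivative_vector_3 derivative_eq_intros has_derivative_vec_nth)

lemma ver_has_derivative: "((\<lambda>p. ver p u) has_derivative (\<lambda>v. ver_deriv p v u)) (at p)"
  unfolding ver_def ver_deriv_def hor_def fib_def hor_deriv_def fib_deriv_def
  by (intro has_derivative_vector_3)
    (auto intro!: derivative_eq_intros has_derivative_vec_nth simp: fun_eq_iff algebra_simps)

lemma sasaki_coframe_has_derivative:
  "((\<lambda>p. (hor p u, ver p u)) has_derivative (\<lambda>v. (hor_deriv v u, ver_deriv p v u))) (at p)"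
  by (intro has_derivative_Pair hor_has_derivative ver_has_derivative)

lemma linear_sasaki_coframe: "linear (\<lambda>u. (hor p u, ver p u))"
  by (rule linearI) (simp_all add: vec3_eq_iff hor_def ver_def algebra_simps)

lemma linear_sasaki_coframe_deriv: "linear (\<lambda>u. (hor_deriv v u, ver_deriv p v u))"
  by (rule linearI) (simp_all add: vec3_eq_iff hor_def hor_deriv_def ver_deriv_def algebra_simps)

lemma vec6_eq_iff: "u = v \<longleftrightarrow> (\<forall>i::3. u $ Inl i = v $ Inl i) \<and> (\<forall>i::3. u $ Inr i = v $ Inr i)"
  for u v :: "'a ^ (3 + 3)"
  by (metis sumE vec_eq_iff)

lemma sasaki_coframe_inject:
  assumes "hor p u = hor p v" "ver p u = ver p v" shows "u = v"
  using assms by (auto simp: vec3_eq_iff vec6_eq_iff forall_3 hor_def ver_def)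

lemma sasaki_coframe_surj: "\<exists>u. hor p u = a \<and> ver p u = b"
proof -
  \<comment> \<open>The system is triangular: the horizontal components \<open>a\<close> determine
    the connection terms in \<open>ver\<close>, and removing these leaves the fibre coordinates
    \<open>c\<close> and \<open>d\<close>.\<close>
  define c where "c = b $ 1 - a $ 2 * fib p $ 3 - a $ 3 * fib p $ 2"
  define d where "d = b $ 2 + a $ 3 * fib p $ 1 + a $ 1 * fib p $ 3"
  define h :: "real ^ 3" where "h = vector [a $ 1, a $ 2, a $ 3 - p $ Inl 2 * a $ 1 + p $ Inl 1 * a $ 2]"
  define k :: "real ^ 3" where "k = vector [c, d, b $ 3 - p $ Inl 2 * c + p $ Inl 1 * d]"
  define u :: "real ^ (3 + 3)" where "u = (\<chi> i. case i of Inl j \<Rightarrow> h $ j | Inr j \<Rightarrow> k $ j)"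
  have "hor p u = a" by (simp add: vec3_eq_iff hor_def u_def h_def)
  moreover have "ver p u = b"
    unfolding ver_def \<open>hor p u = a\<close> by (simp add: vec3_eq_iff u_def k_def c_def d_def)
  ultimately show ?thesis by blast
qed

text \<open>In frame components, the covariant derivative of \<open>w\<close> along a curve with velocity
  \<open>a\<close> is \<open>w' + heis_conn a \<times> w\<close>, and the curvature operator
  \<open>R(y, z)\<close> is, up to sign, the cross product with \<open>heis_curv (y \<times>
  z)\<close>.\<close>

definition heis_conn :: "real ^ 3 \<Rightarrow> real ^ 3" where
  "heis_conn a = vector [a $ 1, a $ 2, - a $ 3]"

definition heis_curv :: "real ^ 3 \<Rightarrow> real ^ 3" where
  "heis_curv a = vector [a $ 1, a $ 2, - 3 * a $ 3]"

lemma cross3_nth: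
  "cross3 a b $ 1 = a $ 2 * b $ 3 - a $ 3 * b $ 2" "cross3 a b $ 2 = a $ 3 * b $ 1 - a $ 1 * b $ 3"
  "cross3 a b $ 3 = a $ 1 * b $ 2 - a $ 2 * b $ 1"
  by (simp_all add: cross3_def)

text \<open>Antisymmetrising the coframe derivative gives its exterior derivative. The right side
  contains \<open>u\<close> only through its frame components, so coefficients can be compared in
  the geodesic equation; the \<open>heis_curv\<close> term is the curvature of the
  connection.\<close>

lemma sasaki_structure_equation:
  "hor p w \<bullet> (hor_deriv w u - hor_deriv u w) + ver p w \<bullet> (ver_deriv p w u - ver_deriv p u w) =
    hor p u \<bullet> (cross3 (heis_conn (hor p w)) (hor p w)
      - cross3 (heis_curv (cross3 (fib p) (ver p w))) (hor p w))
    + ver p u \<bullet> cross3 (heis_conn (hor p w)) (ver p w)"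
  unfolding inner_vec3 cross3_nth
  by (simp add: heis_conn_def heis_curv_def cross3_nth hor_def ver_def fib_def hor_deriv_def
    ver_deriv_def fib_deriv_def) algebra

subsection \<open>Total geodesy and angles\<close>

lemma sasaki_coframe_zero [simp]: "hor p 0 = 0" "ver p 0 = 0"
  by (simp_all add: vec3_eq_iff hor_def ver_def)

lemma has_vector_derivative_velocity:
  "f differentiable (at t) \<Longrightarrow> (f has_vector_derivative velocity f t) (at t)"
  by (simp add: velocity_def vector_derivative_works)

text \<open>The second equation says that the vertical part of the velocity is parallel along the base
  curve, the first one that the acceleration of the base curve is the curvature term of the Sasaki
  metric.\<close>

theorem geodesic_on_heisenberg_sasaki:
  fixes \<gamma> :: "real \<Rightarrow> real ^ (3 + 3)"
  defines "\<phi> \<equiv> \<lambda>t. hor (\<gamma> t) (velocity \<gamma> t)" and "\<psi> \<equiv> \<lambda>t. ver (\<gamma> t) (velocity \<gamma> t)"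
  shows "geodesic_on heisenberg_sasaki J \<gamma> \<longleftrightarrow> open J \<and> is_interval J \<and>
    (\<forall>t\<in>J. \<gamma> differentiable (at t) \<and> velocity \<gamma> differentiable (at t) \<and>
      (\<phi> has_vector_derivative cross3 (heis_curv (cross3 (fib (\<gamma> t)) (\<psi> t)) - heis_conn (\<phi> t)) (\<phi> t)) (at t) \<and>
      (\<psi> has_vector_derivative - cross3 (heis_conn (\<phi> t)) (\<psi> t)) (at t))"
proof -
  define \<Theta> where "\<Theta> p u = (hor p u, ver p u)" for p u
  define D where "D p v u = (hor_deriv v u, ver_deriv p v u)" for p v u
  have metric: "heisenberg_sasaki p u v = \<Theta> p u \<bullet> \<Theta> p v" for p u v
    by (simp add: \<Theta>_def heisenberg_sasaki_eq inner_prod_def)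
  have lin: "linear (\<Theta> p)" for p
    unfolding \<Theta>_def by (rule linear_sasaki_coframe)
  have inj: "inj (\<Theta> p)" for p
    by (auto intro!: injI sasaki_coframe_inject simp: \<Theta>_def)
  have der: "((\<lambda>p. \<Theta> p u) has_derivative (\<lambda>v. D p v u)) (at p)" for p u
    unfolding \<Theta>_def D_def by (rule sasaki_coframe_has_derivative)
  have linD: "linear (D p v)" for p v
    unfolding D_def by (rule linear_sasaki_coframe_deriv)
  have eqv: "(\<forall>u. \<Theta> (\<gamma> t) u \<bullet> (\<Theta> (\<gamma> t) (velocity (velocity \<gamma>) t) + D (\<gamma> t) (velocity \<gamma> t) (velocity \<gamma> t)) +
        \<Theta> (\<gamma> t) (velocity \<gamma> t) \<bullet> (D (\<gamma> t) (velocity \<gamma> t) u - D (\<gamma> t) u (velocity \<gamma> t)) = 0) \<longleftrightarrow>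
      (\<phi> has_vector_derivative cross3 (heis_curv (cross3 (fib (\<gamma> t)) (\<psi> t)) - heis_conn (\<phi> t)) (\<phi> t)) (at t) \<and>
      (\<psi> has_vector_derivative - cross3 (heis_conn (\<phi> t)) (\<psi> t)) (at t)" (is "?L \<longleftrightarrow> ?R")
    if "\<gamma> differentiable (at t)" "velocity \<gamma> differentiable (at t)" for t
  proof -
    \<comment> \<open>\<open>P\<close> and \<open>Q\<close> are the actual derivatives of
      \<open>\<phi>\<close> and \<open>\<psi>\<close>; \<open>P0\<close> and \<open>Q0\<close> are
      the values that the equations prescribe.\<close>
    define P where "P = hor (\<gamma> t) (velocity (velocity \<gamma>) t) + hor_deriv (velocity \<gamma> t) (velocity \<gamma> t)"
    define Q where "Q = ver (\<gamma> t) (velocity (velocity \<gamma>) t) + ver_deriv (\<gamma> t) (velocity \<gamma> t) (velocity \<gamma> t)"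
    define P0 where "P0 = cross3 (heis_curv (cross3 (fib (\<gamma> t)) (\<psi> t)) - heis_conn (\<phi> t)) (\<phi> t)"
    define Q0 where "Q0 = - cross3 (heis_conn (\<phi> t)) (\<psi> t)"
    have "(\<gamma> has_vector_derivative velocity \<gamma> t) (at t)"
      "(velocity \<gamma> has_vector_derivative velocity (velocity \<gamma>) t) (at t)"
      using that has_vector_derivative_velocity by blast+
    from has_vector_derivative_coframe[of \<Theta> D, OF lin der linD this]
    have PQ: "((\<lambda>s. (\<phi> s, \<psi> s)) has_vector_derivative (P, Q)) (at t)"
      by (simp add: \<Theta>_def D_def P_def Q_def \<phi>_def \<psi>_def)
    have P: "(\<phi> has_vector_derivative P) (at t)"
      using bounded_linear.has_vector_derivative[OF bounded_linear_fst PQ] by simp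
    have Q: "(\<psi> has_vector_derivative Q) (at t)"
      using bounded_linear.has_vector_derivative[OF bounded_linear_snd PQ] by simp
    have "?L \<longleftrightarrow> (\<forall>u. hor (\<gamma> t) u \<bullet> (P - P0) + ver (\<gamma> t) u \<bullet> (Q - Q0) = 0)"
    proof -
      have dual: "\<Theta> (\<gamma> t) (velocity \<gamma> t) \<bullet> (D (\<gamma> t) (velocity \<gamma> t) u - D (\<gamma> t) u (velocity \<gamma> t)) =
        - (hor (\<gamma> t) u \<bullet> P0 + ver (\<gamma> t) u \<bullet> Q0)" for u
        using sasaki_structure_equation[of "\<gamma> t" "velocity \<gamma> t" u]
        by (simp add: \<Theta>_def D_def inner_prod_def P0_def Q0_def \<phi>_def \<psi>_def left_diff_distrib
          cross3_simps)
      show ?thesis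
        unfolding dual by (simp add: \<Theta>_def D_def inner_prod_def P_def Q_def inner_diff_right algebra_simps)
    qed
    also have "\<dots> \<longleftrightarrow> P = P0 \<and> Q = Q0"
    proof
      assume *: "\<forall>u. hor (\<gamma> t) u \<bullet> (P - P0) + ver (\<gamma> t) u \<bullet> (Q - Q0) = 0"
      \<comment> \<open>The coframe is onto, so some test vector has the two differences as its
        components, which produces a sum of squares.\<close>
      obtain u where "hor (\<gamma> t) u = P - P0" "ver (\<gamma> t) u = Q - Q0"
        using sasaki_coframe_surj by blast
      with *[rule_format, of u] have "(P - P0) \<bullet> (P - P0) + (Q - Q0) \<bullet> (Q - Q0) = 0" by simp
      then show "P = P0 \<and> Q = Q0"
        by (simp add: add_nonneg_eq_0_iff)
    qed simp
    also have "\<dots> \<longleftrightarrow> ?R"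
      using P Q vector_derivative_unique_at by (auto simp flip: P0_def Q0_def)
    finally show ?thesis .
  qed
  show ?thesis
    unfolding geodesic_on_coframe[of heisenberg_sasaki \<Theta> D, OF metric lin inj der linD]
    using eqv by auto
qed

section \<open>The distributions in frame components\<close>

lemma hor_horizontal_lift: "hor p (horizontal_lift heisenberg_metric X p) = heis_coframe (base_point p) (X (base_point p))"
  and ver_horizontal_lift: "ver p (horizontal_lift heisenberg_metric X p) = 0"
  and hor_vertical_lift: "hor p (vertical_lift X p) = 0"
  and ver_vertical_lift: "ver p (vertical_lift X p) = heis_coframe (base_point p) (X (base_point p))"
  by (simp_all add: parts_of_lifts vec3_eq_iff flip: heis_coframe_parts)

lemma heis_coframe_frame:
  "heis_coframe x (E1 x) = axis 1 1" "heis_coframe x (E2 x) = axis 2 1"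
  by (simp_all add: vec3_eq_iff E1_def E2_def)

lemma hor_add: "hor p (u + v) = hor p u + hor p v" and ver_add: "ver p (u + v) = ver p u + ver p v"
  and hor_scaleR: "hor p (c *\<^sub>R u) = c *\<^sub>R hor p u" and ver_scaleR: "ver p (c *\<^sub>R u) = c *\<^sub>R ver p u"
  using linear_add[OF linear_sasaki_coframe, of p u v] linear_cmul[OF linear_sasaki_coframe, of p c u]
  by simp_all

lemma mem_span_2: "x \<in> span {a, b} \<longleftrightarrow> (\<exists>k l. x = k *\<^sub>R a + l *\<^sub>R b)"
  by (simp add: span_breakdown_eq span_singleton image_iff diff_eq_eq add.commute)

text \<open>The horizontal lifts of \<open>E1\<close> and \<open>E2\<close> are the first two
  coordinate axes of the coframe, so the other four components cut out their span.\<close>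

lemma mem_F_H_iff: "u \<in> F_H p \<longleftrightarrow> hor p u $ 3 = 0 \<and> ver p u = 0"
proof
  assume "u \<in> F_H p"
  then show "hor p u $ 3 = 0 \<and> ver p u = 0"
    by (auto simp: F_H_def spanned_distribution_def mem_span_2 hor_add ver_add hor_scaleR ver_scaleR
      hor_horizontal_lift ver_horizontal_lift heis_coframe_frame)
next
  assume *: "hor p u $ 3 = 0 \<and> ver p u = 0"
  have "u = hor p u $ 1 *\<^sub>R horizontal_lift heisenberg_metric E1 p + hor p u $ 2 *\<^sub>R horizontal_lift heisenberg_metric E2 p"
    using * by (intro sasaki_coframe_inject[of p])
      (simp_all add: hor_add ver_add hor_scaleR ver_scaleR hor_horizontal_lift ver_horizontal_lift
        heis_coframe_frame vec3_eq_iff)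
  then show "u \<in> F_H p" by (auto simp: F_H_def spanned_distribution_def mem_span_2)
qed

lemma mem_F_V_iff: "u \<in> F_V p \<longleftrightarrow> hor p u = 0 \<and> ver p u $ 3 = 0"
proof
  assume "u \<in> F_V p"
  then show "hor p u = 0 \<and> ver p u $ 3 = 0"
    by (auto simp: F_V_def spanned_distribution_def mem_span_2 hor_add ver_add hor_scaleR ver_scaleR
      hor_vertical_lift ver_vertical_lift heis_coframe_frame)
next
  assume *: "hor p u = 0 \<and> ver p u $ 3 = 0"
  have "u = ver p u $ 1 *\<^sub>R vertical_lift E1 p + ver p u $ 2 *\<^sub>R vertical_lift E2 p"
    using * by (intro sasaki_coframe_inject[of p])
      (simp_all add: hor_add ver_add hor_scaleR ver_scaleR hor_vertical_lift ver_vertical_lift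
        heis_coframe_frame vec3_eq_iff)
  then show "u \<in> F_V p" by (auto simp: F_V_def spanned_distribution_def mem_span_2)
qed

section \<open>Conserved quantities and total geodesy\<close>

lemma has_vector_derivative_zero_imp_eq:
  fixes f :: "real \<Rightarrow> 'a::real_normed_vector"
  assumes "is_interval J" "\<And>t. t \<in> J \<Longrightarrow> (f has_vector_derivative 0) (at t)" "s \<in> J" "t \<in> J"
  shows "f s = f t"
proof -
  obtain c where "\<And>x. x \<in> J \<Longrightarrow> f x = c"
    using has_vector_derivative_zero_constant[of J f] assms(1,2)
    by (meson has_vector_derivative_at_within is_interval_convex)
  then show ?thesis using assms by simp
qed

text \<open>The derivative of \<open>f\<close> is orthogonal to \<open>f\<close>, so the length of
  \<open>f\<close> is constant. This takes the place of a uniqueness theorem for differential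
  equations.\<close>

lemma rotation_ode_vanishes:
  fixes f w :: "real \<Rightarrow> real ^ 3"
  assumes "is_interval J" "\<And>t. t \<in> J \<Longrightarrow> (f has_vector_derivative cross3 (w t) (f t)) (at t)"
    and "t0 \<in> J" "f t0 = 0" "t \<in> J"
  shows "f t = 0"
proof -
  have "((\<lambda>s. f s \<bullet> f s) has_vector_derivative 0) (at s)" if "s \<in> J" for s
  proof -
    have "((\<lambda>s. f s \<bullet> f s) has_vector_derivative f s \<bullet> cross3 (w s) (f s) + cross3 (w s) (f s) \<bullet> f s) (at s)"
      using bounded_bilinear.has_vector_derivative[OF bounded_bilinear_inner assms(2)[OF that] assms(2)[OF that]] .
    then show ?thesis by (simp add: dot_cross_self)
  qed
  from has_vector_derivative_zero_imp_eq[OF assms(1) this assms(5,3)]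
  show ?thesis using assms(4) by simp
qed

text \<open>\<open>heis_conn\<close> changes only the third entry. Along geodesics of the base this
  is the conservation of the inner product with the Killing field \<open>E3\<close>.\<close>

lemma heis_conn_cross_self_nth_3: "cross3 (heis_conn a) a $ 3 = 0"
  by (simp add: cross3_nth heis_conn_def)

lemma heis_zero [simp]: "heis_conn 0 = 0" "heis_curv 0 = 0"
  by (simp_all add: vec3_eq_iff heis_conn_def heis_curv_def)

theorem totally_geodesic_F_H: "totally_geodesic heisenberg_sasaki F_H"
  unfolding totally_geodesic_def
proof (intro allI impI, elim bexE, rule ballI)
  fix J \<gamma> t0 t
  assume "geodesic_on heisenberg_sasaki J \<gamma>" and J: "t0 \<in> J" "t \<in> J" and tan: "tangent_at F_H \<gamma> t0"
  define \<phi> where "\<phi> = (\<lambda>t. hor (\<gamma> t) (velocity \<gamma> t))"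
  define \<psi> where "\<psi> = (\<lambda>t. ver (\<gamma> t) (velocity \<gamma> t))"
  have int: "is_interval J" and
    d\<phi>: "\<And>t. t \<in> J \<Longrightarrow> (\<phi> has_vector_derivative cross3 (heis_curv (cross3 (fib (\<gamma> t)) (\<psi> t)) - heis_conn (\<phi> t)) (\<phi> t)) (at t)" and
    d\<psi>: "\<And>t. t \<in> J \<Longrightarrow> (\<psi> has_vector_derivative - cross3 (heis_conn (\<phi> t)) (\<psi> t)) (at t)"
    using \<open>geodesic_on heisenberg_sasaki J \<gamma>\<close>
    unfolding geodesic_on_heisenberg_sasaki \<phi>_def \<psi>_def by blast+
  have t0: "\<phi> t0 $ 3 = 0" "\<psi> t0 = 0"
    using tan by (simp_all add: tangent_at_def mem_F_H_iff \<phi>_def \<psi>_def)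
  have \<psi>0: "\<psi> s = 0" if "s \<in> J" for s
    by (rule rotation_ode_vanishes[of J \<psi> "\<lambda>t. - heis_conn (\<phi> t)" t0])
      (use int d\<psi> J t0 that in \<open>simp_all add: cross_minus_left\<close>)
  \<comment> \<open>With \<open>\<psi> = 0\<close> the curvature term drops out, and the connection
    term does not act on the third component.\<close>
  have "((\<lambda>t. \<phi> t $ 3) has_vector_derivative 0) (at s)" if "s \<in> J" for s
  proof -
    have "((\<lambda>t. \<phi> t $ 3) has_vector_derivative
        cross3 (heis_curv (cross3 (fib (\<gamma> s)) (\<psi> s)) - heis_conn (\<phi> s)) (\<phi> s) $ 3) (at s)"
      using bounded_linear.has_vector_derivative[OF bounded_linear_vec_nth d\<phi>[OF that]] .
    then show ?thesis
      by (simp add: \<psi>0[OF that] cross_minus_left heis_conn_cross_self_nth_3)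
  qed
  from has_vector_derivative_zero_imp_eq[OF int this J(2,1)]
  show "tangent_at F_H \<gamma> t"
    using \<psi>0[OF J(2)] t0 by (simp add: tangent_at_def mem_F_H_iff \<phi>_def \<psi>_def)
qed

theorem totally_geodesic_F_V: "totally_geodesic heisenberg_sasaki F_V"
  unfolding totally_geodesic_def
proof (intro allI impI, elim bexE, rule ballI)
  fix J \<gamma> t0 t
  assume "geodesic_on heisenberg_sasaki J \<gamma>" and J: "t0 \<in> J" "t \<in> J" and tan: "tangent_at F_V \<gamma> t0"
  define \<phi> where "\<phi> = (\<lambda>t. hor (\<gamma> t) (velocity \<gamma> t))"
  define \<psi> where "\<psi> = (\<lambda>t. ver (\<gamma> t) (velocity \<gamma> t))"
  have int: "is_interval J" and
    d\<phi>: "\<And>t. t \<in> J \<Longrightarrow> (\<phi> has_vector_derivative cross3 (heis_curv (cross3 (fib (\<gamma> t)) (\<psi> t)) - heis_conn (\<phi> t)) (\<phi> t)) (at t)" and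
    d\<psi>: "\<And>t. t \<in> J \<Longrightarrow> (\<psi> has_vector_derivative - cross3 (heis_conn (\<phi> t)) (\<psi> t)) (at t)"
    using \<open>geodesic_on heisenberg_sasaki J \<gamma>\<close>
    unfolding geodesic_on_heisenberg_sasaki \<phi>_def \<psi>_def by blast+
  have t0: "\<phi> t0 = 0" "\<psi> t0 $ 3 = 0"
    using tan by (simp_all add: tangent_at_def mem_F_V_iff \<phi>_def \<psi>_def)
  \<comment> \<open>The axis of rotation depends on \<open>\<phi>\<close> itself, but the cross
    product remains orthogonal to \<open>\<phi>\<close>, so a single zero propagates.\<close>
  have \<phi>0: "\<phi> s = 0" if "s \<in> J" for s
    by (rule rotation_ode_vanishes[OF int d\<phi> J(1) t0(1) that])
  have "(\<psi> has_vector_derivative 0) (at s)" if "s \<in> J" for s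
    using d\<psi>[OF that] by (simp add: \<phi>0[OF that])
  from has_vector_derivative_zero_imp_eq[OF int this J(2,1)]
  show "tangent_at F_V \<gamma> t"
    using \<phi>0[OF J(2)] t0 by (simp add: tangent_at_def mem_F_V_iff \<phi>_def \<psi>_def)
qed

text \<open>Here \<open>u\<close> is the orthogonal projection of \<open>v\<close> onto
  \<open>S\<close>. By Cauchy-Schwarz the cosine of the angle between \<open>v\<close> and an
  element of \<open>S\<close> is largest at \<open>u\<close>, so the infimum is attained there. The
  map \<open>T\<close> carries \<open>g p\<close> to a genuine inner product.\<close>

lemma angle_to_subspace_projection:
  assumes pos: "\<And>w. w \<noteq> 0 \<Longrightarrow> g p w w > 0"
    and g: "\<And>v w. g p v w = T v \<bullet> (T w :: 'a::real_inner)"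
    and u: "u \<in> S" "u \<noteq> 0" and orth: "\<And>w. w \<in> S \<Longrightarrow> g p v w = g p u w"
  shows "angle_to_subspace g p v S = arccos (metric_norm g p u / metric_norm g p v)"
proof -
  have norm: "metric_norm g p w = norm (T w)" for w
    by (simp add: metric_norm_def g norm_eq_sqrt_inner)
  have pn: "norm (T w) > 0" if "w \<noteq> 0" for w
    using pos[OF that] by (auto simp: g)
  have vu: "T v \<bullet> T u = (norm (T u))\<^sup>2"
    using orth[OF u(1)] by (simp add: g dot_square_norm)
  have le: "norm (T u) \<le> norm (T v)"
    using norm_cauchy_schwarz[of "T v" "T u"] pn[OF u(2)] by (simp add: vu power2_eq_square)
  have v: "norm (T v) > 0" using pn[OF u(2)] le by linarith
  show ?thesis
    unfolding angle_to_subspace_def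
  proof (rule cInf_eq_minimum)
    show "arccos (metric_norm g p u / metric_norm g p v) \<in> metric_angle g p v ` (S - {0})"
    proof (rule image_eqI[of _ _ u])
      show "arccos (metric_norm g p u / metric_norm g p v) = metric_angle g p v u"
        using pn[OF u(2)] v by (simp add: metric_angle_def norm g vu power2_eq_square)
    qed (use u in simp)
  next
    fix a assume "a \<in> metric_angle g p v ` (S - {0})"
    then obtain w where w: "w \<in> S" "w \<noteq> 0" and a: "a = arccos (T v \<bullet> T w / (norm (T v) * norm (T w)))"
      by (auto simp: metric_angle_def norm g)
    \<comment> \<open>On \<open>S\<close> the vector \<open>v\<close> may be replaced by
      \<open>u\<close>, and Cauchy-Schwarz is applied to \<open>u\<close> and
      \<open>w\<close>.\<close>
    have "T v \<bullet> T w / (norm (T v) * norm (T w)) \<le> norm (T u) / norm (T v)"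
      using norm_cauchy_schwarz[of "T u" "T w"] orth[OF w(1)] v pn[OF w(2)]
      by (simp add: g field_simps)
    moreover have "- 1 \<le> T v \<bullet> T w / (norm (T v) * norm (T w))"
      using Cauchy_Schwarz_ineq2[of "T v" "T w"] v pn[OF w(2)] by (simp add: field_simps)
    moreover have "norm (T u) / norm (T v) \<le> 1" using le v by simp
    ultimately show "arccos (metric_norm g p u / metric_norm g p v) \<le> a"
      unfolding a norm by (intro arccos_le_arccos)
  qed
qed

lemma angle_to_subspace_heisenberg_sasaki:
  assumes "u \<in> S" "u \<noteq> 0" "\<And>w. w \<in> S \<Longrightarrow> heisenberg_sasaki p v w = heisenberg_sasaki p u w"
  shows "angle_to_subspace heisenberg_sasaki p v S =
    arccos (metric_norm heisenberg_sasaki p u / metric_norm heisenberg_sasaki p v)"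
  by (rule angle_to_subspace_projection[of heisenberg_sasaki p "\<lambda>u. (hor p u, ver p u)"])
    (use assms heisenberg_sasaki_pos in \<open>simp_all add: heisenberg_sasaki_eq inner_prod_def\<close>)

text \<open>The projection keeps the first two horizontal components and drops the rest; for a unit
  vector its length is the cosine. The condition on \<open>c\<close> makes the projection
  nonzero.\<close>

lemma angle_to_F_H:
  fixes p v :: "real ^ (3 + 3)"
  defines "c \<equiv> (hor p v $ 1)\<^sup>2 + (hor p v $ 2)\<^sup>2"
  assumes "metric_norm heisenberg_sasaki p v = 1" "c \<noteq> 0"
  shows "angle_to_subspace heisenberg_sasaki p v (F_H p) = arccos (sqrt c)"
proof -
  obtain u where u: "hor p u = vector [hor p v $ 1, hor p v $ 2, 0]" "ver p u = 0"
    using sasaki_coframe_surj by blast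
  have "heisenberg_sasaki p u u = c"
    by (simp add: heisenberg_sasaki_eq u inner_vec3 c_def power2_eq_square)
  moreover have "u \<noteq> 0" using calculation \<open>c \<noteq> 0\<close> by (auto simp: heisenberg_sasaki_eq)
  moreover have "heisenberg_sasaki p v w = heisenberg_sasaki p u w" if "w \<in> F_H p" for w
    using that by (simp add: heisenberg_sasaki_eq u inner_vec3 mem_F_H_iff)
  moreover have "u \<in> F_H p" by (simp add: mem_F_H_iff u)
  ultimately show ?thesis
    using assms(2) by (simp add: angle_to_subspace_heisenberg_sasaki[of u] metric_norm_def)
qed

lemma angle_to_F_V:
  fixes p v :: "real ^ (3 + 3)"
  defines "c \<equiv> (ver p v $ 1)\<^sup>2 + (ver p v $ 2)\<^sup>2"
  assumes "metric_norm heisenberg_sasaki p v = 1" "c \<noteq> 0"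
  shows "angle_to_subspace heisenberg_sasaki p v (F_V p) = arccos (sqrt c)"
proof -
  obtain u where u: "hor p u = 0" "ver p u = vector [ver p v $ 1, ver p v $ 2, 0]"
    using sasaki_coframe_surj by blast
  have "heisenberg_sasaki p u u = c"
    by (simp add: heisenberg_sasaki_eq u inner_vec3 c_def power2_eq_square)
  moreover have "u \<noteq> 0" using calculation \<open>c \<noteq> 0\<close> by (auto simp: heisenberg_sasaki_eq)
  moreover have "heisenberg_sasaki p v w = heisenberg_sasaki p u w" if "w \<in> F_V p" for w
    using that by (simp add: heisenberg_sasaki_eq u inner_vec3 mem_F_V_iff)
  moreover have "u \<in> F_V p" by (simp add: mem_F_V_iff u)
  ultimately show ?thesis
    using assms(2) by (simp add: angle_to_subspace_heisenberg_sasaki[of u] metric_norm_def)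
qed

subsection \<open>Explicit geodesics\<close>

lemma has_vector_derivative_vecI:
  fixes f :: "real \<Rightarrow> real ^ 'n::finite"
  assumes "\<And>i. ((\<lambda>t. f t $ i) has_real_derivative f' $ i) (at t)"
  shows "(f has_vector_derivative f') (at t)"
  unfolding has_vector_derivative_def
proof (subst has_derivative_componentwise_within, intro ballI)
  fix b :: "real ^ 'n" assume "b \<in> Basis"
  then obtain i where "b = axis i 1" by (auto simp: Basis_vec_def)
  then show "((\<lambda>s. f s \<bullet> b) has_derivative (\<lambda>s. (s *\<^sub>R f') \<bullet> b)) (at t)"
    using assms[of i] by (simp add: inner_axis has_field_derivative_def mult_commute_abs mult.commute)
qed

lemma has_real_derivative_vec_nth:
  fixes f :: "real \<Rightarrow> real ^ 'n::finite"
  assumes "(f has_vector_derivative f') (at t)"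
  shows "((\<lambda>t. f t $ i) has_real_derivative f' $ i) (at t)"
  unfolding has_real_derivative_iff_has_vector_derivative
  by (rule bounded_linear.has_vector_derivative[OF bounded_linear_vec_nth assms])

lemma differentiable_vecI:
  fixes f :: "real \<Rightarrow> real ^ 'n::finite"
  assumes "\<And>i. (\<lambda>t. f t $ i) differentiable (at t)"
  shows "f differentiable (at t)"
proof -
  have "\<forall>i. \<exists>d. ((\<lambda>t. f t $ i) has_real_derivative d) (at t)"
    using assms by (simp add: real_differentiable_def)
  then obtain d where "\<And>i. ((\<lambda>t. f t $ i) has_real_derivative d i) (at t)" by metis
  then have "(f has_vector_derivative (\<chi> i. d i)) (at t)"
    by (intro has_vector_derivative_vecI) simp
  then show ?thesis by (rule differentiableI_vector)
qed

text \<open>The tangent vector at \<open>x\<close> whose components in the frame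
  \<open>E1, E2, E3\<close> are \<open>\<eta>\<close>; the third fibre entry converts back to
  coordinate components.\<close>

definition frame_point :: "real ^ 3 \<Rightarrow> real ^ 3 \<Rightarrow> real ^ (3 + 3)" where
  "frame_point x \<eta> = (\<chi> i. case i of Inl j \<Rightarrow> x $ j
     | Inr j \<Rightarrow> (vector [\<eta> $ 1, \<eta> $ 2, \<eta> $ 3 - x $ 2 * \<eta> $ 1 + x $ 1 * \<eta> $ 2] :: real ^ 3) $ j)"

lemma frame_point_nth [simp]:
  "frame_point x \<eta> $ Inl j = x $ j" "frame_point x \<eta> $ Inr 1 = \<eta> $ 1" "frame_point x \<eta> $ Inr 2 = \<eta> $ 2"
  "frame_point x \<eta> $ Inr 3 = \<eta> $ 3 - x $ 2 * \<eta> $ 1 + x $ 1 * \<eta> $ 2"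
  by (simp_all add: frame_point_def)

lemma fib_frame_point: "fib (frame_point x \<eta>) = \<eta>"
  by (simp add: vec3_eq_iff fib_def)

text \<open>The geodesic equation becomes a first-order system: \<open>x\<close> has velocity
  \<open>\<phi>\<close>, the covariant derivative of \<open>\<eta>\<close> is \<open>\<psi>\<close>,
  and \<open>\<phi>\<close>, \<open>\<psi>\<close> obey the two Sasaki equations.\<close>

lemma frame_point_geodesic:
  fixes x \<eta> \<phi> \<psi> :: "real \<Rightarrow> real ^ 3"
  assumes x: "\<And>t. (x has_vector_derivative
      vector [\<phi> t $ 1, \<phi> t $ 2, \<phi> t $ 3 - x t $ 2 * \<phi> t $ 1 + x t $ 1 * \<phi> t $ 2]) (at t)"
    and \<eta>: "\<And>t. (\<eta> has_vector_derivative \<psi> t - cross3 (heis_conn (\<phi> t)) (\<eta> t)) (at t)"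
    and \<phi>: "\<And>t. (\<phi> has_vector_derivative
      cross3 (heis_curv (cross3 (\<eta> t) (\<psi> t)) - heis_conn (\<phi> t)) (\<phi> t)) (at t)"
    and \<psi>: "\<And>t. (\<psi> has_vector_derivative - cross3 (heis_conn (\<phi> t)) (\<psi> t)) (at t)"
    and \<gamma>: "\<And>t. \<gamma> t = frame_point (x t) (\<eta> t)"
  shows "geodesic_on heisenberg_sasaki UNIV \<gamma>"
    and "hor (\<gamma> t) (velocity \<gamma> t) = \<phi> t" and "ver (\<gamma> t) (velocity \<gamma> t) = \<psi> t"
proof -
  define x' where "x' t = (vector [\<phi> t $ 1, \<phi> t $ 2, \<phi> t $ 3 - x t $ 2 * \<phi> t $ 1 + x t $ 1 * \<phi> t $ 2] :: real ^ 3)" for t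
  define \<eta>' where "\<eta>' t = \<psi> t - cross3 (heis_conn (\<phi> t)) (\<eta> t)" for t
  define c :: "real \<Rightarrow> real ^ (3 + 3)" where "c t = (\<chi> i. case i of Inl j \<Rightarrow> x' t $ j
    | Inr j \<Rightarrow> (vector [\<eta>' t $ 1, \<eta>' t $ 2, \<eta>' t $ 3 - (x' t $ 2 * \<eta> t $ 1 + x t $ 2 * \<eta>' t $ 1)
      + (x' t $ 1 * \<eta> t $ 2 + x t $ 1 * \<eta>' t $ 2)] :: real ^ 3) $ j)" for t
  have dx: "((\<lambda>t. x t $ i) has_real_derivative x' t $ i) (at t)" for i t
    unfolding x'_def by (rule has_real_derivative_vec_nth[OF x])
  have d\<eta>: "((\<lambda>t. \<eta> t $ i) has_real_derivative \<eta>' t $ i) (at t)" for i t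
    unfolding \<eta>'_def by (rule has_real_derivative_vec_nth[OF \<eta>])
  have diffs: "(\<lambda>t. x t $ i) differentiable (at t)" "(\<lambda>t. \<eta> t $ i) differentiable (at t)"
    "(\<lambda>t. \<phi> t $ i) differentiable (at t)" "(\<lambda>t. \<psi> t $ i) differentiable (at t)" for i t
    using dx d\<eta> has_real_derivative_vec_nth[OF \<phi>] has_real_derivative_vec_nth[OF \<psi>] unfolding real_differentiable_def by blast+
  have d\<gamma>: "(\<gamma> has_vector_derivative c t) (at t)" for t
  proof (rule has_vector_derivative_vecI)
    fix i :: "3 + 3"
    show "((\<lambda>t. \<gamma> t $ i) has_real_derivative c t $ i) (at t)"
    proof (cases i)
      case (Inl j)
      then show ?thesis using dx by (simp add: \<gamma> c_def)
    next
      case (Inr j)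
      show ?thesis
        unfolding Inr using exhaust_3[of j]
        by (elim disjE) (auto simp: \<gamma> c_def intro!: derivative_eq_intros dx d\<eta>)
    qed
  qed
  then have vel: "velocity \<gamma> = c"
    unfolding velocity_def by (auto intro: vector_derivative_at)
  \<comment> \<open>Differentiability is enough here, since the second-order information is carried
    by the equations for \<open>\<phi>\<close> and \<open>\<psi>\<close>.\<close>
  have dc: "c differentiable (at t)" for t
  proof (rule differentiable_vecI)
    fix i :: "3 + 3"
    show "(\<lambda>t. c t $ i) differentiable (at t)"
    proof (cases i)
      case (Inl j)
      show ?thesis
        unfolding Inl using exhaust_3[of j]
        by (elim disjE) (auto simp: c_def x'_def intro!: derivative_intros diffs)
    next
      case (Inr j)
      show ?thesis
        unfolding Inr using exhaust_3[of j]
        by (elim disjE) (auto simp: c_def x'_def \<eta>'_def cross3_nth heis_conn_def intro!: derivative_intros diffs)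
    qed
  qed
  have hor: "hor (\<gamma> t) (c t) = \<phi> t" for t
    by (simp add: vec3_eq_iff hor_def \<gamma> c_def x'_def)
  have ver: "ver (\<gamma> t) (c t) = \<psi> t" for t
    unfolding ver_def hor
    by (simp add: vec3_eq_iff fib_frame_point \<gamma> c_def x'_def \<eta>'_def cross3_nth heis_conn_def algebra_simps)
  have fib: "fib (\<gamma> t) = \<eta> t" for t
    by (simp add: \<gamma> fib_frame_point)
  show "hor (\<gamma> t) (velocity \<gamma> t) = \<phi> t" "ver (\<gamma> t) (velocity \<gamma> t) = \<psi> t"
    by (simp_all add: vel hor ver)
  show "geodesic_on heisenberg_sasaki UNIV \<gamma>"
    unfolding geodesic_on_heisenberg_sasaki vel hor ver fib
    using d\<gamma> dc \<phi> \<psi> by (auto intro: differentiableI_vector)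
qed

lemma has_vector_derivative_vector_3:
  assumes "(f1 has_real_derivative d1) (at t)" "(f2 has_real_derivative d2) (at t)"
    "(f3 has_real_derivative d3) (at t)"
    and "d $ 1 = d1" "d $ 2 = d2" "d $ 3 = d3"
  shows "((\<lambda>t. vector [f1 t, f2 t, f3 t] :: real ^ 3) has_vector_derivative d) (at t)"
proof (rule has_vector_derivative_vecI)
  fix i :: 3
  show "((\<lambda>t. (vector [f1 t, f2 t, f3 t] :: real ^ 3) $ i) has_real_derivative d $ i) (at t)"
    using exhaust_3[of i] assms by auto
qed

section \<open>Failure of the isocline property\<close>

lemma arccos_sqrt_eq_iff:
  assumes "0 \<le> a" "a \<le> 1" "0 \<le> b" "b \<le> 1"
  shows "arccos (sqrt a) = arccos (sqrt b) \<longleftrightarrow> a = b"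
proof
  assume "arccos (sqrt a) = arccos (sqrt b)"
  moreover have "\<bar>sqrt a\<bar> \<le> 1" "\<bar>sqrt b\<bar> \<le> 1" using assms by auto
  ultimately show "a = b" by (simp add: arccos_eq_iff)
qed simp

text \<open>The base curve is a horizontal line, along which the parallel field \<open>\<psi>\<close>
  rotates in the plane of \<open>E2\<close> and \<open>E3\<close>; the fibre curve is \<open>s
  \<psi>(s)\<close>, so that the curvature term vanishes.\<close>

theorem not_isocline_F_V: "\<not> isocline heisenberg_sasaki F_V"
proof
  assume iso: "isocline heisenberg_sasaki F_V"
  \<comment> \<open>The horizontal speed 3/5 and the vertical speed 4/5 give unit speed. The
    connection makes \<open>\<psi>\<close> rotate at the rate 3/5.\<close>
  define x where "x = (\<lambda>s. vector [3 / 5 * s, 0, 0] :: real ^ 3)"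
  define \<phi> where "\<phi> = (\<lambda>s::real. vector [3 / 5, 0, 0] :: real ^ 3)"
  define \<psi> where "\<psi> = (\<lambda>s. vector [0, 4 / 5 * cos (3 / 5 * s), - 4 / 5 * sin (3 / 5 * s)] :: real ^ 3)"
  define \<eta> where "\<eta> = (\<lambda>s. vector [0, s * (4 / 5 * cos (3 / 5 * s)), s * (- 4 / 5 * sin (3 / 5 * s))] :: real ^ 3)"
  define \<gamma> where "\<gamma> s = frame_point (x s) (\<eta> s)" for s
  have 1: "(x has_vector_derivative
      vector [\<phi> t $ 1, \<phi> t $ 2, \<phi> t $ 3 - x t $ 2 * \<phi> t $ 1 + x t $ 1 * \<phi> t $ 2]) (at t)" for t
    unfolding x_def \<phi>_def
    by (rule has_vector_derivative_vector_3) (auto intro!: derivative_eq_intros)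
  have 2: "(\<eta> has_vector_derivative \<psi> t - cross3 (heis_conn (\<phi> t)) (\<eta> t)) (at t)" for t
    unfolding \<eta>_def \<psi>_def \<phi>_def
    by (rule has_vector_derivative_vector_3) (auto intro!: derivative_eq_intros simp: cross3_nth heis_conn_def field_simps)
  have 3: "(\<phi> has_vector_derivative
      cross3 (heis_curv (cross3 (\<eta> t) (\<psi> t)) - heis_conn (\<phi> t)) (\<phi> t)) (at t)" for t
    unfolding \<eta>_def \<psi>_def \<phi>_def
    by (rule has_vector_derivative_vector_3)
      (auto intro!: derivative_eq_intros simp: cross3_nth heis_conn_def heis_curv_def)
  have 4: "(\<psi> has_vector_derivative - cross3 (heis_conn (\<phi> t)) (\<psi> t)) (at t)" for t
    unfolding \<psi>_def \<phi>_def
    by (rule has_vector_derivative_vector_3) (auto intro!: derivative_eq_intros simp: cross3_nth heis_conn_def)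
  note geo = frame_point_geodesic[OF 1 2 3 4 \<gamma>_def]
  have "\<phi> s \<bullet> \<phi> s + \<psi> s \<bullet> \<psi> s = 1" for s
    unfolding \<phi>_def \<psi>_def inner_vec3 vector_3 using sin_cos_squared_add[of "3 / 5 * s"] by algebra
  then have unit: "metric_norm heisenberg_sasaki (\<gamma> s) (velocity \<gamma> s) = 1" for s
    by (simp add: metric_norm_def heisenberg_sasaki_eq geo)
  then have "arc_length_parametrized heisenberg_sasaki UNIV \<gamma>"
    by (simp add: arc_length_parametrized_def)
  then obtain \<theta> where \<theta>: "\<And>s. angle_to_subspace heisenberg_sasaki (\<gamma> s) (velocity \<gamma> s) (F_V (\<gamma> s)) = \<theta>"
    using iso geo(1) unfolding isocline_def by blast
  have \<theta>_eq: "\<theta> = arccos (sqrt ((4 / 5 * cos (3 / 5 * s))\<^sup>2))" if "cos (3 / 5 * s) \<noteq> 0" for s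
    using angle_to_F_V[of "\<gamma> s" "velocity \<gamma> s", OF unit] that
    unfolding geo \<theta> by (simp add: \<psi>_def)
  \<comment> \<open>At \<open>5 / 9 * pi\<close> the argument of the cosine is
    \<open>pi / 3\<close>, so the component along \<open>F_V\<close> has half its initial
    length.\<close>
  have "arccos (sqrt ((4 / 5)\<^sup>2)) = arccos (sqrt ((2 / 5)\<^sup>2))"
    using \<theta>_eq[of 0] \<theta>_eq[of "5 / 9 * pi"] by (simp add: cos_60 power2_eq_square)
  then show False
    by (subst (asm) arccos_sqrt_eq_iff) (auto simp: power2_eq_square)
qed

text \<open>Since \<open>\<psi>\<close> is parallel, so is \<open>u = \<eta> \<times> \<psi>\<close>, and
  \<open>\<phi>\<close> and \<open>u\<close> obey a closed system of equations in which the third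
  components differ by a constant. If they are equal, then \<open>\<phi>\<^sub>3\<close> is a sine;
  the normalisation \<open>|\<phi>|\<^sup>2 = |u|\<^sup>2 = 1/2\<close>, with \<open>\<phi>\<close>
  and \<open>u\<close> orthogonal at time 0, gives the solution \<open>\<phi> = (1, cos s, sin s) /
  2\<close>, \<open>u = (1, - cos s, sin s) / 2\<close>. In the frame \<open>(1, 0, 0), (0, cos s, -
  sin s), (0, sin s, cos s)\<close> the parallel fields have constant coefficients in their
  equation, and \<open>\<psi>\<close> is the solution orthogonal to \<open>u\<close>, rotating with
  frequency \<open>1 / sqrt 2\<close>. Then \<open>\<eta> = 2 (\<psi> \<times> u) + s
  \<psi>\<close>.\<close>

theorem not_isocline_F_H: "\<not> isocline heisenberg_sasaki F_H"
proof
  assume iso: "isocline heisenberg_sasaki F_H"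
  \<comment> \<open>\<open>(a, a, b)\<close> are the coefficients of \<open>\<psi>\<close> in the
    rotating frame; the equal first two make \<open>\<psi>\<close> orthogonal to \<open>u\<close>.
    They solve \<open>a' = - b / 2\<close>, \<open>b' = a\<close>.\<close>
  define a where "a s = - sin (s * (sqrt 2 / 2)) / 2" for s :: real
  define b where "b s = sqrt 2 / 2 * cos (s * (sqrt 2 / 2))" for s :: real
  define x where "x = (\<lambda>s. vector [s / 2, sin s / 2, s * sin s / 4] :: real ^ 3)"
  define \<phi> where "\<phi> = (\<lambda>s. vector [1 / 2, cos s / 2, sin s / 2] :: real ^ 3)"
  define \<psi> where "\<psi> = (\<lambda>s. vector [a s, a s * cos s + b s * sin s, b s * cos s - a s * sin s] :: real ^ 3)"
  define \<eta> where "\<eta> = (\<lambda>s. vector [b s + s * a s,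
    b s * cos s - 2 * a s * sin s + s * (a s * cos s + b s * sin s),
    - b s * sin s - 2 * a s * cos s + s * (b s * cos s - a s * sin s)] :: real ^ 3)"
  define \<gamma> where "\<gamma> s = frame_point (x s) (\<eta> s)" for s
  have da: "(a has_real_derivative - b s / 2) (at s)" for s
    unfolding a_def b_def by (auto intro!: derivative_eq_intros)
  have db: "(b has_real_derivative a s) (at s)" for s
    unfolding a_def b_def by (auto intro!: derivative_eq_intros simp: field_simps)
  have cs: "sin s * sin s + cos s * cos s = 1" for s :: real
    using sin_cos_squared_add[of s] by (simp add: power2_eq_square)
  \<comment> \<open>The left side is twice the squared length of \<open>\<psi>\<close>.\<close>
  have ab: "4 * (a s * a s) + 2 * (b s * b s) = 1" for s
  proof -
    let ?r = "s * (sqrt 2 / 2)"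
    have "4 * (a s * a s) = sin ?r * sin ?r" by (simp add: a_def)
    moreover have "2 * (b s * b s) = cos ?r * cos ?r" by (simp add: b_def)
    ultimately show ?thesis using cs[of ?r] by simp
  qed
  \<comment> \<open>The right side is \<open>u\<close>. As \<open>\<psi>\<close> is orthogonal to
    \<open>u\<close> with squared length 1/2, twice the cross product of
    \<open>\<psi> \<times> u\<close> with \<open>\<psi>\<close> is \<open>u\<close>, and the summand
    \<open>s \<psi>\<close> contributes nothing.\<close>
  have curv: "cross3 (\<eta> s) (\<psi> s) = vector [1 / 2, - cos s / 2, sin s / 2]" for s
    unfolding vec3_eq_iff cross3_nth \<eta>_def \<psi>_def vector_3
    using cs[of s] ab[of s] by (intro conjI; simp add: field_simps; algebra)
  have 1: "(x has_vector_derivative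
      vector [\<phi> t $ 1, \<phi> t $ 2, \<phi> t $ 3 - x t $ 2 * \<phi> t $ 1 + x t $ 1 * \<phi> t $ 2]) (at t)" for t
    unfolding x_def \<phi>_def
    by (rule has_vector_derivative_vector_3) (auto intro!: derivative_eq_intros simp: field_simps)
  have 2: "(\<eta> has_vector_derivative \<psi> t - cross3 (heis_conn (\<phi> t)) (\<eta> t)) (at t)" for t
    unfolding \<eta>_def \<psi>_def \<phi>_def
    by (rule has_vector_derivative_vector_3, (rule derivative_eq_intros da db refl)+,
      simp_all add: cross3_nth heis_conn_def, simp_all add: field_simps, (use cs[of t] in algebra)+)
  have 3: "(\<phi> has_vector_derivative
      cross3 (heis_curv (cross3 (\<eta> t) (\<psi> t)) - heis_conn (\<phi> t)) (\<phi> t)) (at t)" for t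
    unfolding curv \<phi>_def
    by (rule has_vector_derivative_vector_3)
      (auto intro!: derivative_eq_intros simp: cross3_nth heis_conn_def heis_curv_def)
  have 4: "(\<psi> has_vector_derivative - cross3 (heis_conn (\<phi> t)) (\<psi> t)) (at t)" for t
    unfolding \<psi>_def \<phi>_def
    by (rule has_vector_derivative_vector_3, (rule derivative_eq_intros da db refl)+,
      simp_all add: cross3_nth heis_conn_def, simp_all add: field_simps, (use cs[of t] in algebra)+)
  note geo = frame_point_geodesic[OF 1 2 3 4 \<gamma>_def]
  have "\<phi> s \<bullet> \<phi> s + \<psi> s \<bullet> \<psi> s = 1" for s
    by (simp add: \<phi>_def \<psi>_def inner_vec3, simp add: field_simps, use cs[of s] ab[of s] in algebra)
  then have unit: "metric_norm heisenberg_sasaki (\<gamma> s) (velocity \<gamma> s) = 1" for s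
    by (simp add: metric_norm_def heisenberg_sasaki_eq geo)
  then have "arc_length_parametrized heisenberg_sasaki UNIV \<gamma>"
    by (simp add: arc_length_parametrized_def)
  then obtain \<theta> where \<theta>: "\<And>s. angle_to_subspace heisenberg_sasaki (\<gamma> s) (velocity \<gamma> s) (F_H (\<gamma> s)) = \<theta>"
    using iso geo(1) unfolding isocline_def by blast
  have "\<theta> = arccos (sqrt ((1 / 2)\<^sup>2 + (cos s / 2)\<^sup>2))" for s
  proof -
    have "(1 / 2)\<^sup>2 + (cos s / 2)\<^sup>2 > 0" by (intro add_pos_nonneg) auto
    then show ?thesis
      using angle_to_F_H[of "\<gamma> s" "velocity \<gamma> s", OF unit]
      unfolding geo \<theta> by (simp add: \<phi>_def)
  qed
  \<comment> \<open>The squared cosine of the angle falls from 1/2 to 1/4 between these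
    times.\<close>
  from this[of 0] this[of "pi / 2"]
  have "arccos (sqrt (1 / 2)) = arccos (sqrt (1 / 4))" by (simp add: power2_eq_square)
  then show False
    by (subst (asm) arccos_sqrt_eq_iff) auto
qed

theorem proposition3p5:
  "totally_geodesic heisenberg_sasaki F_H \<and> \<not> isocline heisenberg_sasaki F_H \<and>
   totally_geodesic heisenberg_sasaki F_V \<and> \<not> isocline heisenberg_sasaki F_V"
  using totally_geodesic_F_H not_isocline_F_H totally_geodesic_F_V not_isocline_F_V by blast

end
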